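(* Let $(Y_n,\Gamma_n)_{n\in\mathbb{N}_0}$, $Y_n=(X_n,\phi_n)$, be an AIR MCMC chain with parameter $\beta\in(0,\infty)$ in the setting described in the context, and let $d\colon\mathcal{Y}\times\mathcal{Y}\to[0,\infty)$ be a distance-like function with associated contraction coefficient $\tau(\cdot)$. Assume: (1) there are $M\in[1,\infty)$, $\tau\in[0,1)$ and $k_0\in\mathbb{N}$, independent of $\gamma$, such that $\tau(P_\gamma)\le M$ and $\tau(P_\gamma^{k_0})\le\tau$ for all $\gamma\in\mathcal{I}$; (2) there are a measurable function $V\colon\mathcal{Y}\to[1,\infty)$ and constants $\kappa\in(0,1)$, $b\in(0,\infty)$ such that $P_\gamma V(y)\le\kappa V(y)+b$ for all $\gamma\in\mathcal{I}$ and $y\in\mathcal{Y}$; (3) there are constants $p>2$ and $K\in(0,\infty)$ such that $d(y_1,y_2)\le K\bigl(V^{1/p}(y_1)+V^{1/p}(y_2)\bigr)$ for all $y_1,y_2\in\mathcal{Y}$. Let $f\colon\mathcal{X}\to\mathbb{R}$ be a measurable function such that $h=h_f\colon\mathcal{Y}\to\mathbb{R}$, $h(x,\phi)=f(x)$, is Lipschitz with some constant $L\in(0,\infty)$ with respect to $d$, and $|h|\le V^{1/p}$. Then for every $\varepsilon>\max\bigl\{0,\frac{1}{1+\beta}+\frac1p-\frac12\bigr\}$, $$\lim_{n\to\infty}\frac{1}{n^{1/2+\varepsilon}}\sum_{j=1}^n\bigl(f(X_j)-\nu(f)\bigr)=0\qquad\text{almost surely}.$$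
   Context: Setting. $(\mathcal{X},\mathcal{F}_\mathcal{X},\nu)$ is a probability space, $(\Phi,\mathcal{F}_\Phi)$ is a measurable space, and $\mathcal{Y}=\mathcal{X}\times\Phi$ with $\mathcal{F}_\mathcal{Y}=\mathcal{F}_\mathcal{X}\otimes\mathcal{F}_\Phi$; these are Polish spaces with their (countably generated) Borel $\sigma$-algebras, and $d_\mathcal{Y}$ denotes a metric inducing the Polish topology of $\mathcal{Y}$. $(\mathcal{I},\mathcal{F}_\mathcal{I})$ is a measurable space. $\{\pi_\gamma\}_{\gamma\in\mathcal{I}}$ is a family of probability measures on $\mathcal{Y}$ and $\{P_\gamma\}_{\gamma\in\mathcal{I}}$ a family of transition kernels on $\mathcal{Y}$ such that for every $\gamma$: $\pi_\gamma(B\times\Phi)=\nu(B)$ for all $B\in\mathcal{F}_\mathcal{X}$; $\pi_\gamma$ is the invariant distribution of $P_\gamma$; $P_\gamma$ is $\psi$-irreducible and aperiodic. Moreover $(y,\gamma)\mapsto P_\gamma(y,A)$ is measurable for every $A\in\mathcal{F}_\mathcal{Y}$. Write $\nu(f)=\int f\,d\nu$ and $P_\gamma V(y)=\int V(y')\,P_\gamma(y,dy')$. AIR MCMC chain with parameter $\beta>0$. Put $k_j=\lceil j^\beta\rceil$, $T_0=0$, $T_m=\sum_{j=1}^m k_j$. The chain is a process $(Y_n,\Gamma_n)_{n\in\mathbb{N}_0}$ on a probability space $(\Omega,\mathcal{F},\mathbb{P})$ with values in $\mathcal{Y}\times\mathcal{I}$ such that: $(Y_0,\Gamma_0)=(y_0,\gamma_0)$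 is deterministic; with $\mathcal{F}_n=\sigma(Y_0,\dots,Y_n,\Gamma_0,\dots,\Gamma_n)$ one has $\mathbb{P}[Y_{n+1}\in B\mid\mathcal{F}_n]=P_{\Gamma_n}(Y_n,B)$ a.s. for all $B\in\mathcal{F}_\mathcal{Y}$; $\Gamma_n=U_n(Y_0,\dots,Y_n,\Gamma_0,\dots,\Gamma_{n-1})$ for measurable maps $U_n\colon\mathcal{Y}^{n+1}\times\mathcal{I}^n\to\mathcal{I}$; adaptation happens only at the times $T_m$, i.e. $\Gamma_{i_1}=\Gamma_{i_2}$ whenever $i_1,i_2\in\{T_j,\dots,T_{j+1}-1\}$ for some $j$; and $\omega\mapsto\pi_{\Gamma_n(\omega)}(g)$ is measurable for every measurable $g\colon\mathcal{Y}\to\mathbb{R}$ with $\pi_\gamma(|g|)<\infty$ for all $\gamma$. Write $Y_n=(X_n,\phi_n)$ with $X_n\in\mathcal{X}$, $\phi_n\in\Phi$. Distance-like function: $d\colon\mathcal{Y}\times\mathcal{Y}\to[0,\infty)$ that is symmetric, satisfies $d(x,y)=0\iff x=y$, and is lower semi-continuous w.r.t. the product topology induced by $d_\mathcal{Y}$ (no triangle inequality required). Wasserstein-like function: $\mathcal{W}(\mu_1,\mu_2)=\inf_\xi\int d(x,y)\,\xi(dx,dy)$, infimum over all couplings $\xi$ of the probability measures $\mu_1,\mu_2$. Contraction coefficient: $\tau(P_\gamma^\ell)=\sup_{y_1\ne y_2}\mathcal{W}(P_\gamma^\ell(y_1,\cdot),P_\gamma^\ell(y_2,\cdot))/d(y_1,y_2)$.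 A function $\psi$ is Lipschitz with constant $L$ w.r.t. $d$ if $|\psi(x)-\psi(y)|\le L\,d(x,y)$ for all $x,y$. *)

theory Defs
  imports "HOL-Probability.Probability"
begin

section \<open>Transition kernels\<close>

primrec kernel_power ::
  "('a::topological_space \<Rightarrow> 'a measure) \<Rightarrow> nat \<Rightarrow> 'a \<Rightarrow> 'a measure" where
  "kernel_power P 0 = return borel"
| "kernel_power P (Suc n) = (\<lambda>y. kernel_power P n y \<bind> P)"

definition invariant_for ::
  "'a::topological_space measure \<Rightarrow> ('a \<Rightarrow> 'a measure) \<Rightarrow> bool" where
  "invariant_for \<mu> P \<longleftrightarrow> \<mu> \<bind> P = \<mu>"

text \<open>
  Irreducibility and periodicity follow Meyn and Tweedie: \<open>\<psi>\<close>-irreducibility means that \<open>\<psi>\<close> is a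
  maximal irreducibility measure, and a cycle has to exhaust the state space up to a
  \<open>\<psi>\<close>-null set.
\<close>

definition irreducibility_measure ::
  "('a::topological_space \<Rightarrow> 'a measure) \<Rightarrow> 'a measure \<Rightarrow> bool" where
  "irreducibility_measure P \<psi> \<longleftrightarrow>
     sigma_finite_measure \<psi> \<and> sets \<psi> = sets borel \<and> emeasure \<psi> UNIV > 0 \<and>
     (\<forall>A\<in>sets borel. emeasure \<psi> A > 0 \<longrightarrow>
        (\<forall>y. \<exists>n\<ge>1. emeasure (kernel_power P n y) A > 0))"

definition psi_irreducible ::
  "('a::topological_space \<Rightarrow> 'a measure) \<Rightarrow> 'a measure \<Rightarrow> bool" where
  "psi_irreducible P \<psi> \<longleftrightarrow> irreducibility_measure P \<psi> \<and>
     (\<forall>\<phi>. irreducibility_measure P \<phi> \<longrightarrow> absolutely_continuous \<psi> \<phi>)"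

definition has_cycle ::
  "('a::topological_space \<Rightarrow> 'a measure) \<Rightarrow> 'a measure \<Rightarrow> nat \<Rightarrow> bool" where
  "has_cycle P \<psi> k \<longleftrightarrow> (\<exists>D. (\<forall>i<k. D i \<in> sets borel) \<and> disjoint_family_on D {..<k} \<and>
     (\<forall>i<k. \<forall>y\<in>D i. emeasure (P y) (D (Suc i mod k)) = 1) \<and>
     emeasure \<psi> (- (\<Union>i<k. D i)) = 0)"

definition aperiodic ::
  "('a::topological_space \<Rightarrow> 'a measure) \<Rightarrow> 'a measure \<Rightarrow> bool" where
  "aperiodic P \<psi> \<longleftrightarrow> (\<forall>k\<ge>2. \<not> has_cycle P \<psi> k)"

section \<open>Distance-like functions and contraction coefficients\<close>

definition lower_semicontinuous :: "('a::topological_space \<Rightarrow> real) \<Rightarrow> bool" where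
  "lower_semicontinuous g \<longleftrightarrow> (\<forall>z. \<forall>c<g z. eventually (\<lambda>w. c < g w) (nhds z))"

definition distance_like :: "('a::topological_space \<Rightarrow> 'a \<Rightarrow> real) \<Rightarrow> bool" where
  "distance_like d \<longleftrightarrow>
     (\<forall>x y. d x y \<ge> 0) \<and> (\<forall>x y. d x y = d y x) \<and> (\<forall>x y. d x y = 0 \<longleftrightarrow> x = y) \<and>
     lower_semicontinuous (\<lambda>(x, y). d x y)"

definition couplings ::
  "'a::topological_space measure \<Rightarrow> 'a measure \<Rightarrow> ('a \<times> 'a) measure set" where
  "couplings \<mu>1 \<mu>2 = {\<xi>. sets \<xi> = sets (borel \<Otimes>\<^sub>M borel) \<and>
     distr \<xi> borel fst = \<mu>1 \<and> distr \<xi> borel snd = \<mu>2}"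

definition wasserstein_like ::
  "('a::topological_space \<Rightarrow> 'a \<Rightarrow> real) \<Rightarrow> 'a measure \<Rightarrow> 'a measure \<Rightarrow> ennreal" where
  "wasserstein_like d \<mu>1 \<mu>2 =
     (INF \<xi>\<in>couplings \<mu>1 \<mu>2. \<integral>\<^sup>+ z. ennreal (d (fst z) (snd z)) \<partial>\<xi>)"

text \<open>The value may be infinite; on a one-point space the supremum is empty and equals 0.\<close>

definition contraction_coeff ::
  "('a::topological_space \<Rightarrow> 'a \<Rightarrow> real) \<Rightarrow> ('a \<Rightarrow> 'a measure) \<Rightarrow> ennreal" where
  "contraction_coeff d Q =
     (SUP (y1, y2)\<in>{(y1, y2). y1 \<noteq> y2}. wasserstein_like d (Q y1) (Q y2) / ennreal (d y1 y2))"

definition lipschitz_wrt ::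
  "('a \<Rightarrow> 'a \<Rightarrow> real) \<Rightarrow> real \<Rightarrow> ('a \<Rightarrow> real) \<Rightarrow> bool" where
  "lipschitz_wrt d L g \<longleftrightarrow> (\<forall>x y. \<bar>g x - g y\<bar> \<le> L * d x y)"

section \<open>AIR MCMC chains\<close>

definition air_lag :: "real \<Rightarrow> nat \<Rightarrow> nat" where
  "air_lag \<beta> j = nat \<lceil>real j powr \<beta>\<rceil>"

definition air_time :: "real \<Rightarrow> nat \<Rightarrow> nat" where
  "air_time \<beta> m = (\<Sum>j=1..m. air_lag \<beta> j)"

definition history_algebra ::
  "'w measure \<Rightarrow> 'i measure \<Rightarrow> (nat \<Rightarrow> 'w \<Rightarrow> 'a::topological_space) \<Rightarrow> (nat \<Rightarrow> 'w \<Rightarrow> 'i) \<Rightarrow>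
     nat \<Rightarrow> 'w measure" where
  "history_algebra M I Y \<Gamma> n = sigma (space M)
     ({Y i -` A \<inter> space M | i A. i \<le> n \<and> A \<in> sets borel} \<union>
      {\<Gamma> i -` B \<inter> space M | i B. i \<le> n \<and> B \<in> sets I})"

text \<open>
  The product type carries the product topology, whose Borel \<open>\<sigma>\<close>-algebra is the product
  \<open>\<sigma>\<close>-algebra by second countability.
\<close>

locale air_setting =
  fixes \<nu> :: "'x::polish_space measure"
    and I :: "'i measure"
    and \<pi> :: "'i \<Rightarrow> ('x \<times> 'p::polish_space) measure"
    and P :: "'i \<Rightarrow> ('x \<times> 'p) \<Rightarrow> ('x \<times> 'p) measure"
  assumes prob_nu: "prob_space \<nu>"
    and sets_nu: "sets \<nu> = sets borel"
    and prob_pi: "\<gamma> \<in> space I \<Longrightarrow> prob_space (\<pi> \<gamma>)"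
    and sets_pi: "\<gamma> \<in> space I \<Longrightarrow> sets (\<pi> \<gamma>) = sets borel"
    and kernel: "\<gamma> \<in> space I \<Longrightarrow> P \<gamma> \<in> borel \<rightarrow>\<^sub>M prob_algebra borel"
    and marginal_pi:
      "\<gamma> \<in> space I \<Longrightarrow> B \<in> sets borel \<Longrightarrow> emeasure (\<pi> \<gamma>) (B \<times> UNIV) = emeasure \<nu> B"
    and invariant: "\<gamma> \<in> space I \<Longrightarrow> invariant_for (\<pi> \<gamma>) (P \<gamma>)"
    and irreducible_aperiodic:
      "\<gamma> \<in> space I \<Longrightarrow> \<exists>\<psi>. psi_irreducible (P \<gamma>) \<psi> \<and> aperiodic (P \<gamma>) \<psi>"
    and jointly_measurable:
      "A \<in> sets borel \<Longrightarrow> (\<lambda>(y, \<gamma>). emeasure (P \<gamma> y) A) \<in> borel_measurable (borel \<Otimes>\<^sub>M I)"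

text \<open>
  In \<open>adaptation_rule\<close> the history is passed to \<open>U n\<close> as a pair of finite families, indexed by
  \<open>{..n}\<close> and \<open>{..<n}\<close> respectively.
\<close>

locale air_chain = air_setting \<nu> I \<pi> P + prob_space M
  for \<nu> :: "'x::polish_space measure"
    and I :: "'i measure"
    and \<pi> :: "'i \<Rightarrow> ('x \<times> 'p::polish_space) measure"
    and P :: "'i \<Rightarrow> ('x \<times> 'p) \<Rightarrow> ('x \<times> 'p) measure"
    and M :: "'w measure" +
  fixes \<beta> :: real
    and Y :: "nat \<Rightarrow> 'w \<Rightarrow> 'x \<times> 'p"
    and \<Gamma> :: "nat \<Rightarrow> 'w \<Rightarrow> 'i"
    and U :: "nat \<Rightarrow> (nat \<Rightarrow> 'x \<times> 'p) \<times> (nat \<Rightarrow> 'i) \<Rightarrow> 'i"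
    and y0 :: "'x \<times> 'p"
    and \<gamma>0 :: 'i
  assumes beta_pos: "\<beta> > 0"
    and measurable_Y: "Y n \<in> M \<rightarrow>\<^sub>M borel"
    and measurable_Gamma: "\<Gamma> n \<in> M \<rightarrow>\<^sub>M I"
    and start: "\<omega> \<in> space M \<Longrightarrow> Y 0 \<omega> = y0 \<and> \<Gamma> 0 \<omega> = \<gamma>0"
    and transition: "B \<in> sets borel \<Longrightarrow>
      AE \<omega> in M. real_cond_exp M (history_algebra M I Y \<Gamma> n)
          (indicator {\<omega>' \<in> space M. Y (Suc n) \<omega>' \<in> B}) \<omega> =
        measure (P (\<Gamma> n \<omega>) (Y n \<omega>)) B"
    and measurable_U: "U n \<in> PiM {..n} (\<lambda>_. borel) \<Otimes>\<^sub>M PiM {..<n} (\<lambda>_. I) \<rightarrow>\<^sub>M I"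
    and adaptation_rule: "\<omega> \<in> space M \<Longrightarrow>
      \<Gamma> n \<omega> = U n (\<lambda>i\<in>{..n}. Y i \<omega>, \<lambda>i\<in>{..<n}. \<Gamma> i \<omega>)"
    and adaptation_times: "\<omega> \<in> space M \<Longrightarrow>
      i1 \<in> {air_time \<beta> j..<air_time \<beta> (Suc j)} \<Longrightarrow>
      i2 \<in> {air_time \<beta> j..<air_time \<beta> (Suc j)} \<Longrightarrow> \<Gamma> i1 \<omega> = \<Gamma> i2 \<omega>"
    and measurable_pi_Gamma: "g \<in> borel_measurable borel \<Longrightarrow>
      (\<And>\<gamma>. \<gamma> \<in> space I \<Longrightarrow> integrable (\<pi> \<gamma>) g) \<Longrightarrow>
      (\<lambda>\<omega>. \<integral>y. (g y :: real) \<partial>\<pi> (\<Gamma> n \<omega>)) \<in> borel_measurable M"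

end

theory Submission
  imports Defs
begin

text \<open>
  Kernels act on Lipschitz functions: integrating an \<open>l\<close>-Lipschitz function against a kernel with
  contraction coefficient at most \<open>t\<close> gives a \<open>t * l\<close>-Lipschitz function. Iterating this for \<open>h\<close>
  itself makes \<open>P\<^sub>\<gamma>\<^sup>k h\<close> converge geometrically to \<open>\<nu>(f)\<close>, uniformly in \<open>\<gamma>\<close> relative to \<open>V powr (1 / p)\<close>,
  without any gluing of couplings. The series of the differences solves the Poisson equation and splits
  the centred sum into a martingale with bounded second moments of increments and boundary terms.
  The martingale is of order \<open>n powr (1 / 2 + \<epsilon>)\<close> by Kolmogorov's maximal inequality along dyadic times
  and Borel-Cantelli. The boundary terms telescope except at the adaptation times, of which there are
  \<open>O(n powr (1 / (1 + \<beta>)))\<close> up to \<open>n\<close>, and each of them is \<open>O(n powr (1 / p + \<delta>))\<close> almost surely because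
  \<open>V (Y n)\<close> is bounded in expectation.
\<close>

section \<open>Contraction of Lipschitz functions\<close>

text \<open>The parameters may wander forever, so each estimate has to hold with constants common to
  all \<gamma>. Two facts make this possible. The constants of the Poisson solution come only from
  the contraction, drift and growth bounds, and all invariant laws share the marginal \<nu>, so the
  centring constant is the same for every kernel although the laws differ. The contraction
  coefficient enters through the easy half of Kantorovich duality only: every coupling bounds the
  difference of two integrals of a Lipschitz function by the Lipschitz constant times its cost.
  Lipschitz constants simply multiply when kernels are applied in turn, while \<open>d\<close> has
  no triangle inequality to compare measures with. The threshold for \<epsilon> balances the two
  parts of the sum: about \<open>n powr (1 / (1 + \<beta>))\<close> boundary terms of size
  \<open>n powr (1 / p + \<delta>)\<close> must be beaten by
  \<open>n powr (1 / 2 + \<epsilon>)\<close>, and the martingale needs \<epsilon> positive. The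
  bound on \<open>p\<close> makes the square of a function of order \<open>V powr (1 / p)\<close> at
  most of order \<open>V\<close>, so the first moment of \<open>V\<close> controls all second
  moments.\<close>

lemma integral_bind_iterated:
  fixes f :: "'b \<Rightarrow> real"
  assumes f[measurable]: "f \<in> borel_measurable B"
    and N[measurable]: "N \<in> M \<rightarrow>\<^sub>M subprob_algebra B"
    and ne: "space M \<noteq> {}"
    and int: "integrable (M \<bind> N) f"
  shows "(\<integral>y. f y \<partial>(M \<bind> N)) = (\<integral>x. \<integral>y. f y \<partial>N x \<partial>M)"
proof -
  \<comment> \<open>The positive and negative parts go through the nonnegative rule separately,
    because \<open>f\<close> is known to be integrable under \<open>N x\<close> for almost every
    \<open>x\<close> only.\<close>
  define p where "p x = (\<integral>\<^sup>+y. ennreal (f y) \<partial>N x)" for x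
  define q where "q x = (\<integral>\<^sup>+y. ennreal (- f y) \<partial>N x)" for x
  have sets_N: "sets (N x) = sets B" if "x \<in> space M" for x
    using sets_kernel[OF N that] .
  have [measurable]: "p \<in> borel_measurable M" "q \<in> borel_measurable M"
    unfolding p_def q_def by measurable
  have bindp: "(\<integral>\<^sup>+y. ennreal (f y) \<partial>(M \<bind> N)) = (\<integral>\<^sup>+x. p x \<partial>M)"
    and bindq: "(\<integral>\<^sup>+y. ennreal (- f y) \<partial>(M \<bind> N)) = (\<integral>\<^sup>+x. q x \<partial>M)"
    unfolding p_def q_def by (rule nn_integral_bind[where B=B]; measurable)+
  have finp: "(\<integral>\<^sup>+x. p x \<partial>M) \<noteq> \<infinity>" and finq: "(\<integral>\<^sup>+x. q x \<partial>M) \<noteq> \<infinity>"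
    using int unfolding bindp[symmetric] bindq[symmetric] real_integrable_def by auto
  have aep: "AE x in M. p x \<noteq> \<infinity>" and aeq: "AE x in M. q x \<noteq> \<infinity>"
    by (rule nn_integral_PInf_AE; use finp finq in simp)+
  have eq: "AE x in M. (\<integral>y. f y \<partial>N x) = enn2real (p x) - enn2real (q x)"
    using aep aeq AE_space
  proof eventually_elim
    case (elim x)
    have "f \<in> borel_measurable (N x)"
      using sets_N[OF elim(3)] f by (simp cong: measurable_cong_sets)
    with elim have "integrable (N x) f"
      unfolding real_integrable_def p_def q_def by simp
    then show ?case
      by (simp add: real_lebesgue_integral_def p_def q_def)
  qed
  have rp: "(\<integral>\<^sup>+x. ennreal (enn2real (p x)) \<partial>M) = (\<integral>\<^sup>+x. p x \<partial>M)"
    and rq: "(\<integral>\<^sup>+x. ennreal (enn2real (q x)) \<partial>M) = (\<integral>\<^sup>+x. q x \<partial>M)"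
    by (rule nn_integral_cong_AE; use aep aeq in \<open>auto simp: less_top\<close>)+
  have ip: "integrable M (\<lambda>x. enn2real (p x))" and iq: "integrable M (\<lambda>x. enn2real (q x))"
    using finp finq by (auto intro!: integrableI_nonneg simp: rp rq less_top)
  have "(\<integral>x. \<integral>y. f y \<partial>N x \<partial>M) = (\<integral>x. enn2real (p x) - enn2real (q x) \<partial>M)"
    by (rule integral_cong_AE[OF _ _ eq]) auto
  also have "\<dots> = (\<integral>x. enn2real (p x) \<partial>M) - (\<integral>x. enn2real (q x) \<partial>M)"
    using ip iq by simp
  also have "(\<integral>x. enn2real (p x) \<partial>M) = enn2real (\<integral>\<^sup>+x. p x \<partial>M)"
    by (subst integral_eq_nn_integral) (simp_all add: rp)
  also have "(\<integral>x. enn2real (q x) \<partial>M) = enn2real (\<integral>\<^sup>+x. q x \<partial>M)"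
    by (subst integral_eq_nn_integral) (simp_all add: rq)
  finally show "(\<integral>y. f y \<partial>(M \<bind> N)) = (\<integral>x. \<integral>y. f y \<partial>N x \<partial>M)"
    using int by (simp add: real_lebesgue_integral_def bindp bindq)
qed

text \<open>Under a coupling both integrals live on one space and the Lipschitz bound applies
  pointwise. Dividing by \<open>l\<close> on the left keeps the right-hand side a bare coupling
  cost, so the infimum over couplings can be taken at once.\<close>

lemma abs_integral_diff_le_coupling:
  fixes h :: "'a::topological_space \<Rightarrow> real"
  assumes \<xi>: "\<xi> \<in> couplings \<mu>1 \<mu>2"
    and h: "integrable \<mu>1 h" "integrable \<mu>2 h" "h \<in> borel_measurable borel"
    and lip: "lipschitz_wrt d l h" and l: "0 < l"
  shows "ennreal (\<bar>(\<integral>x. h x \<partial>\<mu>1) - (\<integral>x. h x \<partial>\<mu>2)\<bar> / l) \<le> (\<integral>\<^sup>+z. ennreal (d (fst z) (snd z)) \<partial>\<xi>)"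
proof -
  note h(3)[measurable]
  have s[measurable_cong]: "sets \<xi> = sets (borel \<Otimes>\<^sub>M borel)"
    and m: "distr \<xi> borel fst = \<mu>1" "distr \<xi> borel snd = \<mu>2"
    using \<xi> by (auto simp: couplings_def)
  have i1: "integrable \<xi> (\<lambda>z. h (fst z))" and i2: "integrable \<xi> (\<lambda>z. h (snd z))"
    using h(1,2) unfolding m[symmetric] by (simp_all add: integrable_distr_eq)
  have "(\<integral>x. h x \<partial>\<mu>1) - (\<integral>x. h x \<partial>\<mu>2) = (\<integral>z. h (fst z) - h (snd z) \<partial>\<xi>)"
    unfolding m[symmetric] using i1 i2 by (simp add: integral_distr)
  then have "ennreal (\<bar>(\<integral>x. h x \<partial>\<mu>1) - (\<integral>x. h x \<partial>\<mu>2)\<bar> / l) = ennreal (norm (\<integral>z. (h (fst z) - h (snd z)) / l \<partial>\<xi>))"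
    using l by simp
  also have "\<dots> \<le> (\<integral>\<^sup>+z. ennreal (norm ((h (fst z) - h (snd z)) / l)) \<partial>\<xi>)"
    using i1 i2 by (intro integral_norm_bound_ennreal) simp
  also have "\<dots> \<le> (\<integral>\<^sup>+z. ennreal (d (fst z) (snd z)) \<partial>\<xi>)"
    using lip l by (intro nn_integral_mono ennreal_leI)
      (simp add: pos_divide_le_eq mult.commute lipschitz_wrt_def)
  finally show ?thesis .
qed

text \<open>Duality bounds the difference of integrals by \<open>l\<close> times the
  Wasserstein-like cost, and the coefficient bounds that cost by \<open>t * d x y\<close>. The
  supremum defining the coefficient omits the diagonal, where both sides vanish because
  \<open>d x x = 0\<close>.\<close>

lemma lipschitz_wrt_contraction:
  fixes h :: "'a::topological_space \<Rightarrow> real"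
  assumes d: "distance_like d"
    and Q: "contraction_coeff d Q \<le> ennreal t" "0 \<le> t"
    and h: "h \<in> borel_measurable borel" "\<And>y. integrable (Q y) h"
    and lip: "lipschitz_wrt d l h" and l: "0 < l"
  shows "lipschitz_wrt d (t * l) (\<lambda>y. \<integral>z. h z \<partial>Q y)"
  unfolding lipschitz_wrt_def
proof (intro allI)
  fix x y
  show "\<bar>(\<integral>z. h z \<partial>Q x) - (\<integral>z. h z \<partial>Q y)\<bar> \<le> t * l * d x y"
  proof (cases "x = y")
    case True
    then have "d x y = 0" using d by (simp add: distance_like_def)
    then show ?thesis using True by simp
  next
    case False
    then have dpos: "0 < d x y"
      using d by (metis distance_like_def less_eq_real_def)
    have "wasserstein_like d (Q x) (Q y) / ennreal (d x y) \<le> contraction_coeff d Q"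
      unfolding contraction_coeff_def using False by (intro SUP_upper2[of "(x, y)"]) auto
    then have "wasserstein_like d (Q x) (Q y) / ennreal (d x y) \<le> ennreal t"
      using Q(1) by simp
    then have "wasserstein_like d (Q x) (Q y) / ennreal (d x y) * ennreal (d x y)
        \<le> ennreal t * ennreal (d x y)"
      by (rule mult_right_mono) simp
    moreover have "wasserstein_like d (Q x) (Q y) / ennreal (d x y) * ennreal (d x y)
        = wasserstein_like d (Q x) (Q y)"
      using dpos by (simp add: divide_ennreal_def mult.assoc ennreal_inverse_mult inverse_ennreal
          ennreal_mult[symmetric])
    ultimately have W: "wasserstein_like d (Q x) (Q y) \<le> ennreal (t * d x y)"
      using Q(2) dpos by (simp add: ennreal_mult)
    have "ennreal (\<bar>(\<integral>z. h z \<partial>Q x) - (\<integral>z. h z \<partial>Q y)\<bar> / l) \<le> wasserstein_like d (Q x) (Q y)"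
      unfolding wasserstein_like_def
      by (intro INF_greatest abs_integral_diff_le_coupling[of _ "Q x" "Q y"] h lip l)
    also note W
    finally show ?thesis
      using l Q(2) dpos by (simp add: pos_divide_le_eq mult_ac)
  qed
qed

section \<open>The Poisson equation\<close>

lemma nn_integral_invariant_drift_le:
  fixes V :: "'a::topological_space \<Rightarrow> real"
  assumes P[measurable]: "P \<in> borel \<rightarrow>\<^sub>M prob_algebra borel"
    and \<mu>: "prob_space \<mu>" "sets \<mu> = sets borel" "invariant_for \<mu> P"
    and V[measurable]: "V \<in> borel_measurable borel" and V_ge: "\<And>y. 0 \<le> V y"
    and \<kappa>: "0 \<le> \<kappa>" "\<kappa> < 1" and b: "0 \<le> b"
    and drift: "\<And>y. (\<integral>\<^sup>+z. ennreal (V z) \<partial>P y) \<le> ennreal (\<kappa> * V y + b)"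
  shows "(\<integral>\<^sup>+y. ennreal (V y) \<partial>\<mu>) \<le> ennreal (b / (1 - \<kappa>))"
proof -
  interpret \<mu>: prob_space \<mu> by fact
  note \<mu>(2)[measurable_cong]
  have P'[measurable]: "P \<in> borel \<rightarrow>\<^sub>M subprob_algebra borel"
    by (rule measurable_prob_algebraD) fact
  have P_prob: "prob_space (P y)" for y
    using measurable_space[OF P, of y] by (simp add: space_prob_algebra)
  \<comment> \<open>\<open>\<mu>\<close>-integrability of \<open>V\<close> is not known yet, so the drift inequality is integrated for truncations.\<close>
  define u w where "u n y = min (V y) (real n)" and "w n y = min (\<kappa> * V y + b) (real n)" for n y
  have [measurable]: "u n \<in> borel_measurable borel" "w n \<in> borel_measurable borel" for n
    unfolding u_def w_def by measurable
  have u_ge: "0 \<le> u n y" and w_ge: "0 \<le> w n y" for n y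
    using V_ge[of y] \<kappa> b by (simp_all add: u_def w_def)
  have step: "(\<integral>\<^sup>+z. ennreal (u n z) \<partial>P y) \<le> ennreal (w n y)" for n y
  proof -
    interpret P: prob_space "P y" by (rule P_prob)
    have "(\<integral>\<^sup>+z. ennreal (u n z) \<partial>P y) \<le> (\<integral>\<^sup>+z. ennreal (V z) \<partial>P y)"
      by (intro nn_integral_mono ennreal_leI) (simp add: u_def)
    moreover have "(\<integral>\<^sup>+z. ennreal (u n z) \<partial>P y) \<le> (\<integral>\<^sup>+z. ennreal (real n) \<partial>P y)"
      by (intro nn_integral_mono ennreal_leI) (simp add: u_def)
    ultimately show ?thesis
      using drift[of y] by (auto simp: w_def min_def P.emeasure_space_1)
  qed
  have w_fin: "(\<integral>\<^sup>+y. ennreal (w n y) \<partial>\<mu>) \<noteq> \<top>" for n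
  proof -
    have "(\<integral>\<^sup>+y. ennreal (w n y) \<partial>\<mu>) \<le> (\<integral>\<^sup>+y. ennreal (real n) \<partial>\<mu>)"
      by (intro nn_integral_mono ennreal_leI) (simp add: w_def)
    then show ?thesis by (auto simp: \<mu>.emeasure_space_1 top_unique)
  qed
  have diff: "0 \<le> u n y + b - w n y" for n y
  proof -
    have "\<kappa> * V y \<le> V y" using \<kappa> V_ge[of y] by (simp add: mult_left_le_one_le)
    then show ?thesis using b by (auto simp: u_def w_def min_def)
  qed
  \<comment> \<open>By invariance \<open>step\<close> integrates to an inequality between finite
    numbers. Adding \<open>b\<close> makes the difference of the truncations nonnegative, as Fatou's
    lemma will require.\<close>
  have bound: "(\<integral>\<^sup>+y. ennreal (u n y + b - w n y) \<partial>\<mu>) \<le> ennreal b" for n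
  proof -
    have "(\<integral>\<^sup>+y. ennreal (u n y) \<partial>\<mu>) = (\<integral>\<^sup>+y. ennreal (u n y) \<partial>(\<mu> \<bind> P))"
      using \<mu>(3) by (simp add: invariant_for_def)
    also have "\<dots> = (\<integral>\<^sup>+y. \<integral>\<^sup>+z. ennreal (u n z) \<partial>P y \<partial>\<mu>)"
      by (rule nn_integral_bind[where B=borel]) measurable
    also have "\<dots> \<le> (\<integral>\<^sup>+y. ennreal (w n y) \<partial>\<mu>)"
      by (intro nn_integral_mono step)
    finally have le: "(\<integral>\<^sup>+y. ennreal (u n y) \<partial>\<mu>) \<le> (\<integral>\<^sup>+y. ennreal (w n y) \<partial>\<mu>)" .
    have "(\<integral>\<^sup>+y. ennreal (w n y) \<partial>\<mu>) + (\<integral>\<^sup>+y. ennreal (u n y + b - w n y) \<partial>\<mu>)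
        = (\<integral>\<^sup>+y. ennreal (w n y) + ennreal (u n y + b - w n y) \<partial>\<mu>)"
      by (rule nn_integral_add[symmetric]) measurable
    also have "\<dots> = (\<integral>\<^sup>+y. ennreal (u n y) + ennreal b \<partial>\<mu>)"
      using diff w_ge u_ge b by (intro nn_integral_cong) (simp flip: ennreal_plus)
    also have "\<dots> = (\<integral>\<^sup>+y. ennreal (u n y) \<partial>\<mu>) + ennreal b"
      by (subst nn_integral_add) (simp_all add: \<mu>.emeasure_space_1)
    also have "\<dots> \<le> (\<integral>\<^sup>+y. ennreal (w n y) \<partial>\<mu>) + ennreal b"
      by (intro add_right_mono le)
    finally show ?thesis
      using w_fin[of n] by (simp add: ennreal_add_left_cancel_le)
  qed
  \<comment> \<open>For fixed \<open>y\<close> both truncations are inactive from some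
    \<open>n\<close> on, so the integrand is eventually constant and Fatou's lemma recovers the
    untruncated \<open>V\<close>.\<close>
  have lim: "liminf (\<lambda>n. ennreal (u n y + b - w n y)) = ennreal ((1 - \<kappa>) * V y)" for y
  proof (intro lim_imp_Liminf tendsto_eventually)
    obtain N where N: "max (V y) (\<kappa> * V y + b) \<le> real N" using real_arch_simple by blast
    show "\<forall>\<^sub>F n in sequentially. ennreal (u n y + b - w n y) = ennreal ((1 - \<kappa>) * V y)"
      using eventually_ge_at_top[of N]
    proof eventually_elim
      case (elim n)
      then have "max (V y) (\<kappa> * V y + b) \<le> real n" using N by linarith
      then show ?case by (simp add: u_def w_def min_def algebra_simps)
    qed
  qed simp
  have "ennreal (1 - \<kappa>) * (\<integral>\<^sup>+y. ennreal (V y) \<partial>\<mu>) = (\<integral>\<^sup>+y. ennreal (1 - \<kappa>) * ennreal (V y) \<partial>\<mu>)"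
    by (rule nn_integral_cmult[symmetric]) measurable
  also have "\<dots> = (\<integral>\<^sup>+y. liminf (\<lambda>n. ennreal (u n y + b - w n y)) \<partial>\<mu>)"
    using \<kappa> V_ge by (simp add: lim ennreal_mult)
  also have "\<dots> \<le> liminf (\<lambda>n. \<integral>\<^sup>+y. ennreal (u n y + b - w n y) \<partial>\<mu>)"
    by (rule nn_integral_liminf) measurable
  also have "\<dots> \<le> liminf (\<lambda>n. ennreal b)"
    by (intro Liminf_mono) (simp add: bound)
  also have "\<dots> = ennreal b" by (simp add: Liminf_const)
  finally have *: "ennreal (1 - \<kappa>) * (\<integral>\<^sup>+y. ennreal (V y) \<partial>\<mu>) \<le> ennreal b" .
  have "(\<integral>\<^sup>+y. ennreal (V y) \<partial>\<mu>) \<noteq> \<top>"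
  proof
    assume "(\<integral>\<^sup>+y. ennreal (V y) \<partial>\<mu>) = \<top>"
    with * \<kappa> show False by (simp add: ennreal_mult_top top_unique)
  qed
  then obtain r where "0 \<le> r" and r: "(\<integral>\<^sup>+y. ennreal (V y) \<partial>\<mu>) = ennreal r"
    by (cases "\<integral>\<^sup>+y. ennreal (V y) \<partial>\<mu>" rule: ennreal_cases) auto
  then show ?thesis
    using * \<kappa> b by (simp add: ennreal_mult[symmetric] pos_le_divide_eq mult.commute)
qed

section \<open>Iterates of a single contracting kernel\<close>

primrec kernel_iterate ::
  "('a \<Rightarrow> 'a measure) \<Rightarrow> ('a \<Rightarrow> real) \<Rightarrow> nat \<Rightarrow> 'a \<Rightarrow> real" where
  "kernel_iterate P h 0 = h"
| "kernel_iterate P h (Suc k) = (\<lambda>y. \<integral>z. kernel_iterate P h k z \<partial>P y)"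

text \<open>The Neumann series for the inverse of identity minus \<open>P\<close> on centred
  functions. The centring \<open>c\<close> is a separate argument so that the chain can use one
  constant for all parameters.\<close>

definition poisson_solution ::
  "('a \<Rightarrow> 'a measure) \<Rightarrow> ('a \<Rightarrow> real) \<Rightarrow> real \<Rightarrow> 'a \<Rightarrow> real" where
  "poisson_solution P h c y = (\<Sum>k. kernel_iterate P h k y - c)"

text \<open>\<open>d\<close>, \<open>V\<close>, \<open>h\<close> and the numbers are meant to be
  shared by a whole family while \<open>P\<close> and \<open>\<mu>\<close> vary, so a bound in terms
  of the numbers and \<open>V\<close> is uniform over the family. Positivity of
  \<open>\<tau>\<close> permits division by it and a positive root.\<close>

locale contracting_kernel =
  fixes P :: "'a::topological_space \<Rightarrow> 'a measure" and \<mu> :: "'a measure"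
    and d :: "'a \<Rightarrow> 'a \<Rightarrow> real" and V h :: "'a \<Rightarrow> real"
    and C \<tau> \<kappa> b p K L :: real and k0 :: nat
  assumes P[measurable]: "P \<in> borel \<rightarrow>\<^sub>M prob_algebra borel"
    and \<mu>: "prob_space \<mu>" "sets \<mu> = sets borel" "invariant_for \<mu> P"
    and d: "distance_like d"
    and C: "1 \<le> C" "contraction_coeff d P \<le> ennreal C"
    and \<tau>: "0 < \<tau>" "\<tau> < 1" and k0: "1 \<le> k0"
    and contr: "contraction_coeff d (kernel_power P k0) \<le> ennreal \<tau>"
    and V[measurable]: "V \<in> borel_measurable borel" and V_ge: "1 \<le> V y"
    and \<kappa>: "0 < \<kappa>" "\<kappa> < 1" and b: "0 < b"
    and drift: "(\<integral>\<^sup>+z. ennreal (V z) \<partial>P y) \<le> ennreal (\<kappa> * V y + b)"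
    and p: "1 \<le> p" and K: "0 < K"
    and d_le: "d x y \<le> K * (V x powr (1 / p) + V y powr (1 / p))"
    and h[measurable]: "h \<in> borel_measurable borel"
    and L: "0 < L" "lipschitz_wrt d L h"
    and h_le: "\<bar>h y\<bar> \<le> V y powr (1 / p)"
begin

lemma V_root_le: "V y powr (1 / p) \<le> V y"
  using powr_mono[of "1 / p" 1 "V y"] V_ge[of y] p by simp

lemma V_root_ge: "1 \<le> V y powr (1 / p)"
  using V_ge[of y] p by (simp add: ge_one_powr_ge_zero)

lemma P_subprob[measurable]: "P \<in> borel \<rightarrow>\<^sub>M subprob_algebra borel"
  by (rule measurable_prob_algebraD) (rule P)

lemma prob_P: "prob_space (P y)" and sets_P: "sets (P y) = sets borel"
  using measurable_space[OF P, of y] by (simp_all add: space_prob_algebra)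

lemma kernel_power_measurable[measurable]: "kernel_power P k \<in> borel \<rightarrow>\<^sub>M prob_algebra borel"
  by (induction k) (auto intro!: measurable_bind_prob_space[OF _ P])

lemma prob_kernel_power: "prob_space (kernel_power P k y)"
  and sets_kernel_power: "sets (kernel_power P k y) = sets borel"
  using measurable_space[OF kernel_power_measurable, of y] by (simp_all add: space_prob_algebra)

lemma integrable_dominated:
  fixes u :: "'a \<Rightarrow> real"
  assumes N: "sets N = sets borel" "(\<integral>\<^sup>+z. ennreal (V z) \<partial>N) < \<top>"
    and u[measurable]: "u \<in> borel_measurable borel" and le: "\<And>y. \<bar>u y\<bar> \<le> c * V y"
  shows "integrable N u"
proof -
  note N(1)[measurable_cong]
  \<comment> \<open>The bound at any one point forces this, since \<open>V\<close> is positive;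
    \<open>undefined\<close> stands for such a point.\<close>
  have c: "0 \<le> c"
  proof (rule ccontr)
    assume "\<not> 0 \<le> c"
    then have "c * V undefined < 0" using V_ge[of undefined] by (simp add: mult_neg_pos)
    then show False using le[of undefined] by linarith
  qed
  have "(\<integral>\<^sup>+z. ennreal \<bar>u z\<bar> \<partial>N) \<le> (\<integral>\<^sup>+z. ennreal c * ennreal (V z) \<partial>N)"
    using c V_ge by (intro nn_integral_mono) (simp add: ennreal_mult''[symmetric] ennreal_leI le order_trans[OF zero_le_one])
  also have "\<dots> = ennreal c * (\<integral>\<^sup>+z. ennreal (V z) \<partial>N)"
    by (rule nn_integral_cmult) measurable
  also have "\<dots> < \<top>" using N(2) by (simp add: ennreal_mult_less_top)
  finally show ?thesis by (intro integrableI_bounded) auto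
qed

text \<open>Because \<open>V\<close> is at least 1, the additive \<open>b\<close> can be absorbed
  into a multiple of \<open>V\<close>. The factor \<open>\<kappa> + b\<close> may exceed 1, so its
  powers can grow with \<open>k\<close>; they serve for integrability only.\<close>

lemma nn_integral_V_P: "(\<integral>\<^sup>+z. ennreal (V z) \<partial>P y) \<le> ennreal ((\<kappa> + b) * V y)"
proof -
  have "b \<le> b * V y" using V_ge[of y] b by simp
  then show ?thesis
    by (intro order_trans[OF drift] ennreal_leI) (simp add: algebra_simps)
qed

lemma nn_integral_V_kernel_power:
  "(\<integral>\<^sup>+z. ennreal (V z) \<partial>kernel_power P k y) \<le> ennreal ((\<kappa> + b) ^ k * V y)"
proof (induction k)
  case 0
  then show ?case by (simp add: nn_integral_return)
next
  case (Suc k)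
  note sets_kernel_power[measurable_cong]
  have "(\<integral>\<^sup>+z. ennreal (V z) \<partial>kernel_power P (Suc k) y)
      = (\<integral>\<^sup>+x. \<integral>\<^sup>+z. ennreal (V z) \<partial>P x \<partial>kernel_power P k y)"
    unfolding kernel_power.simps by (rule nn_integral_bind[where B=borel]) measurable
  also have "\<dots> \<le> (\<integral>\<^sup>+x. ennreal (\<kappa> + b) * ennreal (V x) \<partial>kernel_power P k y)"
    using \<kappa> b nn_integral_V_P by (intro nn_integral_mono) (simp add: ennreal_mult')
  also have "\<dots> = ennreal (\<kappa> + b) * (\<integral>\<^sup>+x. ennreal (V x) \<partial>kernel_power P k y)"
    by (rule nn_integral_cmult) measurable
  also have "\<dots> \<le> ennreal (\<kappa> + b) * ennreal ((\<kappa> + b) ^ k * V y)"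
    by (intro mult_left_mono Suc) simp
  also have "\<dots> = ennreal ((\<kappa> + b) ^ Suc k * V y)"
    using \<kappa> b V_ge[of y] by (simp add: ennreal_mult'[symmetric] mult.assoc del: ennreal_plus)
  finally show ?case .
qed

lemma nn_integral_V_fin:
  "(\<integral>\<^sup>+z. ennreal (V z) \<partial>P y) < \<top>" "(\<integral>\<^sup>+z. ennreal (V z) \<partial>kernel_power P k y) < \<top>"
  using nn_integral_V_P[of y] nn_integral_V_kernel_power[of k y]
  by (auto simp: less_top[symmetric] top_unique)

lemma integrable_P:
  fixes u :: "'a \<Rightarrow> real"
  assumes "u \<in> borel_measurable borel" "\<And>y. \<bar>u y\<bar> \<le> c * V y"
  shows "integrable (P y) u" "integrable (kernel_power P k y) u"
  by (rule integrable_dominated; use assms sets_P sets_kernel_power nn_integral_V_fin in auto)+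

lemma kernel_iterate_measurable[measurable]: "kernel_iterate P h k \<in> borel_measurable borel"
proof (induction k)
  case (Suc k)
  note [measurable] = Suc
  show ?case unfolding kernel_iterate.simps by measurable
qed simp

lemma kernel_iterate_le: "\<bar>kernel_iterate P h k y\<bar> \<le> (\<kappa> + b) ^ k * V y"
proof (induction k arbitrary: y)
  case 0
  then show ?case using h_le[of y] V_root_le[of y] by simp
next
  case (Suc k)
  note sets_P[measurable_cong]
  have "ennreal \<bar>kernel_iterate P h (Suc k) y\<bar> \<le> (\<integral>\<^sup>+z. ennreal \<bar>kernel_iterate P h k z\<bar> \<partial>P y)"
    using integral_norm_bound_ennreal[OF integrable_P(1)[OF kernel_iterate_measurable Suc]] by simp
  also have "\<dots> \<le> (\<integral>\<^sup>+z. ennreal ((\<kappa> + b) ^ k) * ennreal (V z) \<partial>P y)"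
    using \<kappa> b Suc by (intro nn_integral_mono) (simp add: ennreal_mult'[symmetric] ennreal_leI)
  also have "\<dots> = ennreal ((\<kappa> + b) ^ k) * (\<integral>\<^sup>+z. ennreal (V z) \<partial>P y)"
    by (rule nn_integral_cmult) measurable
  also have "\<dots> \<le> ennreal ((\<kappa> + b) ^ k) * ennreal ((\<kappa> + b) * V y)"
    by (intro mult_left_mono nn_integral_V_P) simp
  also have "\<dots> = ennreal ((\<kappa> + b) ^ Suc k * V y)"
    using \<kappa> b by (simp add: ennreal_mult'[symmetric] mult_ac)
  finally show ?case
    using \<kappa> b V_ge[of y] by simp
qed

lemma integrable_kernel_iterate:
  "integrable (P y) (kernel_iterate P h k)" "integrable (kernel_power P j y) (kernel_iterate P h k)"
  using integrable_P[OF kernel_iterate_measurable kernel_iterate_le] by auto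

text \<open>\<open>kernel_iterate\<close> adds its new step at the start,
  \<open>kernel_power\<close> at the end. Moving one step at a time across reconciles the two, which
  lets the contraction of the \<open>k0\<close>-step kernel act on the iterates.\<close>

lemma kernel_iterate_add:
  "kernel_iterate P h (k + j) y = (\<integral>z. kernel_iterate P h k z \<partial>kernel_power P j y)"
proof (induction j arbitrary: k)
  case 0
  then show ?case by (simp add: integral_return)
next
  case (Suc j)
  note sets_kernel_power[measurable_cong]
  have "kernel_iterate P h (k + Suc j) y = (\<integral>x. kernel_iterate P h (Suc k) x \<partial>kernel_power P j y)"
    using Suc[of "Suc k"] by simp
  also have "\<dots> = (\<integral>x. \<integral>z. kernel_iterate P h k z \<partial>P x \<partial>kernel_power P j y)" by simp
  also have "\<dots> = (\<integral>z. kernel_iterate P h k z \<partial>kernel_power P (Suc j) y)"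
    unfolding kernel_power.simps
    using integrable_kernel_iterate(2)[of "Suc j" y k] prob_space.not_empty[OF prob_kernel_power]
    by (intro integral_bind_iterated[symmetric, where B=borel]) auto
  finally show ?case .
qed

text \<open>Contraction by \<open>\<tau>\<close> over \<open>k0\<close> steps, spread evenly over
  single steps.\<close>

definition rate where "rate = root k0 \<tau>"
text \<open>The factor \<open>C ^ k0 / \<tau>\<close> pays for an incomplete block: fewer than
  \<open>k0\<close> steps cost at most \<open>C ^ k0\<close>, while \<open>rate ^ k\<close> is still
  at least \<open>\<tau>\<close>.\<close>

definition lip_const where "lip_const = L * C ^ k0 / \<tau>"

lemma rate: "0 < rate" "rate < 1" "rate ^ k0 = \<tau>"
  using \<tau> k0 by (auto simp: rate_def)

lemma lip_const_pos: "0 < lip_const"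
  using L C \<tau> by (simp add: lip_const_def)

lemma lipschitz_kernel_iterate_crude: "lipschitz_wrt d (C ^ k * L) (kernel_iterate P h k)"
proof (induction k)
  case (Suc k)
  then show ?case
    using lipschitz_wrt_contraction[OF d C(2) _ kernel_iterate_measurable integrable_kernel_iterate(1) Suc]
      C L by (simp add: mult.assoc)
qed (use L in simp)

lemma lipschitz_wrt_mono:
  assumes "lipschitz_wrt d l u" "l \<le> l'"
  shows "lipschitz_wrt d l' u"
proof -
  have "0 \<le> d x y" for x y using d by (simp add: distance_like_def)
  then show ?thesis
    using assms unfolding lipschitz_wrt_def by (meson mult_right_mono order_trans)
qed

text \<open>Strong induction in blocks of \<open>k0\<close> steps: each full block multiplies by
  \<open>\<tau> = rate ^ k0\<close>, and the remaining fewer than \<open>k0\<close> steps are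
  covered by the one-step bound \<open>C\<close>.\<close>

lemma lipschitz_kernel_iterate: "lipschitz_wrt d (lip_const * rate ^ k) (kernel_iterate P h k)"
proof (induction k rule: less_induct)
  case (less k)
  show ?case
  proof (cases "k < k0")
    case True
    have "\<tau> \<le> rate ^ k"
      using rate True power_decreasing[of k k0 rate] by simp
    moreover have "C ^ k \<le> C ^ k0" using True C by (simp add: power_increasing)
    ultimately have "C ^ k * \<tau> \<le> C ^ k0 * rate ^ k"
      using C \<tau> by (intro mult_mono) auto
    then have "C ^ k * L * \<tau> \<le> L * C ^ k0 * rate ^ k"
      using L by (simp add: mult_ac)
    then have "C ^ k * L \<le> lip_const * rate ^ k"
      using \<tau> by (simp add: lip_const_def pos_le_divide_eq)
    then show ?thesis by (rule lipschitz_wrt_mono[OF lipschitz_kernel_iterate_crude])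
  next
    case False
    then have "lipschitz_wrt d (lip_const * rate ^ (k - k0)) (kernel_iterate P h (k - k0))"
      using k0 by (intro less) simp
    then have "lipschitz_wrt d (\<tau> * (lip_const * rate ^ (k - k0)))
        (\<lambda>y. \<integral>z. kernel_iterate P h (k - k0) z \<partial>kernel_power P k0 y)"
      using \<tau> lip_const_pos rate(1)
      by (intro lipschitz_wrt_contraction[OF d contr] integrable_kernel_iterate) auto
    moreover have "\<tau> * (lip_const * rate ^ (k - k0)) = lip_const * rate ^ k"
      using False power_add[of rate k0 "k - k0"] rate(3) by simp
    ultimately show ?thesis
      using False by (simp add: kernel_iterate_add[symmetric])
  qed
qed

section \<open>Convergence to the invariant mean and the Poisson solution\<close>

definition inv_bound where "inv_bound = b / (1 - \<kappa>)"

lemma nn_integral_V_invariant: "(\<integral>\<^sup>+y. ennreal (V y) \<partial>\<mu>) \<le> ennreal inv_bound"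
  unfolding inv_bound_def using \<kappa> b V_ge
  by (intro nn_integral_invariant_drift_le[OF P \<mu> V] drift) (auto intro: order_trans[OF zero_le_one])

lemma integrable_invariant:
  fixes u :: "'a \<Rightarrow> real"
  assumes "u \<in> borel_measurable borel" "\<And>y. \<bar>u y\<bar> \<le> c * V y"
  shows "integrable \<mu> u"
  using assms \<mu>(2) nn_integral_V_invariant by (intro integrable_dominated) (auto simp: less_top[symmetric] top_unique)

lemma integral_kernel_iterate_invariant: "(\<integral>y. kernel_iterate P h k y \<partial>\<mu>) = (\<integral>y. h y \<partial>\<mu>)"
proof (induction k)
  case (Suc k)
  note \<mu>(2)[measurable_cong]
  have inv: "\<mu> \<bind> P = \<mu>" using \<mu>(3) by (simp add: invariant_for_def)
  have "(\<integral>y. kernel_iterate P h (Suc k) y \<partial>\<mu>) = (\<integral>y. kernel_iterate P h k y \<partial>(\<mu> \<bind> P))"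
    unfolding kernel_iterate.simps
    using integrable_invariant[OF kernel_iterate_measurable kernel_iterate_le] prob_space.not_empty[OF \<mu>(1)]
    by (intro integral_bind_iterated[symmetric, where B=borel]) (auto simp: inv)
  then show ?case using Suc by (simp add: inv)
qed simp

lemma integrable_V_invariant: "integrable \<mu> V" and integral_V_invariant: "(\<integral>y. V y \<partial>\<mu>) \<le> inv_bound"
proof -
  show int: "integrable \<mu> V"
    using V_ge by (intro integrable_invariant[where c=1]) (auto simp: abs_if order_trans[OF zero_le_one] not_less)
  have "ennreal (\<integral>y. V y \<partial>\<mu>) \<le> ennreal inv_bound"
    using nn_integral_V_invariant V_ge
    by (subst nn_integral_eq_integral[symmetric, OF int]) (auto intro!: AE_I2 intro: order_trans[OF zero_le_one])
  then show "(\<integral>y. V y \<partial>\<mu>) \<le> inv_bound"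
    using \<kappa> b by (simp add: inv_bound_def)
qed

text \<open>Since the iterate has the same \<mu>-mean as \<open>h\<close>, the error is the
  \<mu>-average over \<open>z\<close> of its differences between \<open>y\<close> and
  \<open>z\<close>. The Lipschitz bound and \<open>d_le\<close> turn these into sums of roots of
  \<open>V\<close>; the mean root is at most the mean of \<open>V\<close>, and a root at least 1
  absorbs the constant.\<close>

lemma kernel_iterate_converges:
  "\<bar>kernel_iterate P h k y - (\<integral>z. h z \<partial>\<mu>)\<bar>
    \<le> lip_const * K * (1 + inv_bound) * rate ^ k * V y powr (1 / p)"
proof -
  interpret \<mu>: prob_space \<mu> by (rule \<mu>)
  let ?H = "kernel_iterate P h k" and ?W = "\<lambda>y. V y powr (1 / p)"
  note \<mu>(2)[measurable_cong]
  have iH: "integrable \<mu> ?H"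
    by (rule integrable_invariant[OF kernel_iterate_measurable kernel_iterate_le])
  have iW: "integrable \<mu> ?W"
    using V_root_le by (intro integrable_invariant[where c=1]) auto
  have W: "(\<integral>z. ?W z \<partial>\<mu>) \<le> inv_bound"
    by (rule order_trans[OF integral_mono[OF iW integrable_V_invariant V_root_le] integral_V_invariant])
  have lp: "0 \<le> lip_const * rate ^ k" using lip_const_pos rate by simp
  have "?H y - (\<integral>z. h z \<partial>\<mu>) = (\<integral>z. ?H y - ?H z \<partial>\<mu>)"
    using iH by (simp add: integral_kernel_iterate_invariant \<mu>.prob_space)
  also have "\<bar>\<dots>\<bar> \<le> (\<integral>z. \<bar>?H y - ?H z\<bar> \<partial>\<mu>)"
    by (rule integral_abs_bound)
  also have "\<dots> \<le> (\<integral>z. lip_const * rate ^ k * (K * (?W y + ?W z)) \<partial>\<mu>)"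
  proof (rule integral_mono)
    fix z
    have "\<bar>?H y - ?H z\<bar> \<le> lip_const * rate ^ k * d y z"
      using lipschitz_kernel_iterate by (simp add: lipschitz_wrt_def)
    also have "\<dots> \<le> lip_const * rate ^ k * (K * (?W y + ?W z))"
      by (intro mult_left_mono d_le lp)
    finally show "\<bar>?H y - ?H z\<bar> \<le> lip_const * rate ^ k * (K * (?W y + ?W z))" .
  qed (use iH iW in auto)
  also have "\<dots> = lip_const * rate ^ k * (K * (?W y + (\<integral>z. ?W z \<partial>\<mu>)))"
    using iW by (simp add: \<mu>.prob_space)
  also have "\<dots> \<le> lip_const * rate ^ k * (K * (?W y + inv_bound * ?W y))"
  proof -
    have "inv_bound * 1 \<le> inv_bound * ?W y"
      using V_root_ge[of y] \<kappa> b by (intro mult_left_mono) (auto simp: inv_bound_def)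
    with W have "(\<integral>z. ?W z \<partial>\<mu>) \<le> inv_bound * ?W y" by linarith
    then show ?thesis using lp K by (intro mult_left_mono add_left_mono) auto
  qed
  finally show ?thesis by (simp add: algebra_simps)
qed

text \<open>It depends on neither \<open>P\<close> nor \<open>\<mu>\<close>; this is the source of
  the uniformity over parameters.\<close>

definition poisson_bound where "poisson_bound = lip_const * K * (1 + inv_bound) / (1 - rate)"

abbreviation "g \<equiv> poisson_solution P h (\<integral>z. h z \<partial>\<mu>)"

lemma poisson_terms_summable: "summable (\<lambda>k. \<bar>kernel_iterate P h k y - (\<integral>z. h z \<partial>\<mu>)\<bar>)"
proof (rule summable_comparison_test')
  show "summable (\<lambda>k. lip_const * K * (1 + inv_bound) * V y powr (1 / p) * rate ^ k)"
    using rate by (intro summable_mult summable_geometric) simp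
qed (use kernel_iterate_converges in \<open>simp add: mult_ac\<close>)

lemma poisson_solution_le: "\<bar>g y\<bar> \<le> poisson_bound * V y powr (1 / p)"
proof -
  let ?a = "lip_const * K * (1 + inv_bound) * V y powr (1 / p)"
  have "\<bar>g y\<bar> \<le> (\<Sum>k. \<bar>kernel_iterate P h k y - (\<integral>z. h z \<partial>\<mu>)\<bar>)"
    unfolding poisson_solution_def by (rule summable_rabs[OF poisson_terms_summable])
  also have "\<dots> \<le> (\<Sum>k. ?a * rate ^ k)"
    using rate kernel_iterate_converges
    by (intro suminf_le poisson_terms_summable summable_mult summable_geometric) (auto simp: mult_ac)
  also have "\<dots> = ?a * (1 / (1 - rate))"
    using rate by (subst suminf_mult) (auto simp: suminf_geometric)
  finally show ?thesis by (simp add: poisson_bound_def)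
qed

lemma poisson_solution_measurable[measurable]: "g \<in> borel_measurable borel"
  unfolding poisson_solution_def by measurable

text \<open>Integrating against \<open>P y\<close> shifts the series by one index, so only its first
  term survives in the difference. The geometric bound justifies exchanging sum and
  integral.\<close>

lemma poisson_equation: "g y - (\<integral>z. g z \<partial>P y) = h y - (\<integral>z. h z \<partial>\<mu>)"
proof -
  interpret P: prob_space "P y" by (rule prob_P)
  note sets_P[measurable_cong]
  let ?c = "\<integral>z. h z \<partial>\<mu>" and ?a = "lip_const * K * (1 + inv_bound)"
  let ?H = "kernel_iterate P h"
  have iW: "integrable (P y) (\<lambda>z. V z powr (1 / p))"
    by (rule integrable_P(1)[where c=1]) (use V_root_le in auto)
  have "(\<integral>z. g z \<partial>P y) = (\<Sum>k. \<integral>z. ?H k z - ?c \<partial>P y)"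
    unfolding poisson_solution_def
  proof (rule integral_suminf)
    show "integrable (P y) (\<lambda>z. ?H k z - ?c)" for k
      using integrable_kernel_iterate(1) by simp
    show "AE z in P y. summable (\<lambda>k. norm (?H k z - ?c))"
      using poisson_terms_summable by simp
    show "summable (\<lambda>k. \<integral>z. norm (?H k z - ?c) \<partial>P y)"
    proof (rule summable_comparison_test')
      show "summable (\<lambda>k. (?a * (\<integral>z. V z powr (1 / p) \<partial>P y)) * rate ^ k)"
        using rate by (intro summable_mult summable_geometric) simp
      fix k
      have "(\<integral>z. norm (?H k z - ?c) \<partial>P y) \<le> (\<integral>z. ?a * rate ^ k * V z powr (1 / p) \<partial>P y)"
        using integrable_kernel_iterate(1) iW kernel_iterate_converges by (intro integral_mono) auto
      then show "norm (\<integral>z. norm (?H k z - ?c) \<partial>P y) \<le> (?a * (\<integral>z. V z powr (1 / p) \<partial>P y)) * rate ^ k"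
        by (simp add: mult_ac)
    qed
  qed
  also have "\<dots> = (\<Sum>k. ?H (Suc k) y - ?c)"
    using integrable_kernel_iterate(1) by (simp add: P.prob_space)
  also have "\<dots> = g y - (?H 0 y - ?c)"
    unfolding poisson_solution_def
    by (subst suminf_split_head[OF summable_rabs_cancel[OF poisson_terms_summable]]) simp
  finally show ?thesis by simp
qed

end

section \<open>Square-integrable martingale differences\<close>

lemma integrable_mult_of_sq:
  fixes X Z :: "'a \<Rightarrow> real"
  assumes [measurable]: "X \<in> borel_measurable M" "Z \<in> borel_measurable M"
    and sq: "integrable M (\<lambda>\<omega>. (X \<omega>)\<^sup>2)" "integrable M (\<lambda>\<omega>. (Z \<omega>)\<^sup>2)"
  shows "integrable M (\<lambda>\<omega>. X \<omega> * Z \<omega>)"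
proof (rule Bochner_Integration.integrable_bound)
  show "integrable M (\<lambda>\<omega>. (X \<omega>)\<^sup>2 + (Z \<omega>)\<^sup>2)" using sq by simp
  have "\<bar>x * y\<bar> \<le> x\<^sup>2 + y\<^sup>2" for x y :: real
  proof -
    have "2 * (\<bar>x\<bar> * \<bar>y\<bar>) \<le> x\<^sup>2 + y\<^sup>2" using sum_squares_bound[of "\<bar>x\<bar>" "\<bar>y\<bar>"] by simp
    moreover have "0 \<le> \<bar>x\<bar> * \<bar>y\<bar>" by simp
    ultimately show ?thesis unfolding abs_mult by linarith
  qed
  then show "AE \<omega> in M. norm (X \<omega> * Z \<omega>) \<le> norm ((X \<omega>)\<^sup>2 + (Z \<omega>)\<^sup>2)" by simp
qed measurable

text \<open>The maximal inequality is Markov's inequality for the sum frozen as soon as it reaches the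
  level \<open>l\<close>; freezing keeps the increments orthogonal.\<close>

primrec stopped_sum :: "real \<Rightarrow> (nat \<Rightarrow> 'w \<Rightarrow> real) \<Rightarrow> nat \<Rightarrow> 'w \<Rightarrow> real" where
  "stopped_sum l D 0 = (\<lambda>_. 0)"
| "stopped_sum l D (Suc n) = (\<lambda>\<omega>. stopped_sum l D n \<omega> + (if \<bar>stopped_sum l D n \<omega>\<bar> < l then D n \<omega> else 0))"

lemma stopped_sum_frozen:
  assumes "l \<le> \<bar>stopped_sum l D n \<omega>\<bar>" "n \<le> N"
  shows "stopped_sum l D N \<omega> = stopped_sum l D n \<omega>"
  using assms(2) by (induction N rule: dec_induct) (use assms(1) in auto)

lemma stopped_sum_cases: "l \<le> \<bar>stopped_sum l D n \<omega>\<bar> \<or> stopped_sum l D n \<omega> = (\<Sum>j<n. D j \<omega>)"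
  by (induction n) auto

text \<open>By time \<open>n\<close> the stopped sum either has reached the level and is frozen, or
  agrees with the partial sum and reaches it now. A maximum over \<open>n \<le> N\<close> thus
  becomes an event at the single time \<open>N\<close>.\<close>

lemma stopped_sum_maximal:
  assumes "l \<le> \<bar>\<Sum>j<n. D j \<omega>\<bar>" "n \<le> N"
  shows "l \<le> \<bar>stopped_sum l D N \<omega>\<bar>"
proof -
  have "l \<le> \<bar>stopped_sum l D n \<omega>\<bar>" using stopped_sum_cases[of l D n \<omega>] assms(1) by auto
  then show ?thesis using stopped_sum_frozen[OF _ assms(2)] by metis
qed

text \<open>A time between two consecutive powers of 2 is controlled at the upper one, which is less
  than twice the time; this is the 2 in the conclusion.\<close>

lemma eventually_powr_of_dyadic:
  fixes S :: "nat \<Rightarrow> real"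
  assumes a: "0 < a" and ev: "\<forall>\<^sub>F k in sequentially. \<forall>n\<le>2 ^ k. \<bar>S n\<bar> < real (2 ^ k) powr a"
  shows "\<forall>\<^sub>F n in sequentially. \<bar>S n\<bar> \<le> (2 * real n) powr a"
proof -
  obtain N where N: "\<And>k n. N \<le> k \<Longrightarrow> n \<le> 2 ^ k \<Longrightarrow> \<bar>S n\<bar> < real (2 ^ k) powr a"
    using ev by (auto simp: eventually_sequentially)
  show ?thesis
    \<comment> \<open>The threshold makes \<open>n\<close> at least 2, as the dyadic bracketing
      needs, and pushes the exponent past \<open>N\<close>.\<close>
    using eventually_ge_at_top[of "2 ^ N + 2"]
  proof eventually_elim
    case (elim n)
    then have "2 \<le> n" by simp
    then obtain m where m: "2 ^ m < n" "n \<le> 2 ^ (m + 1)"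
      using ex_power_ivl2[of 2 n] by auto
    have "(2::nat) ^ N < 2 ^ (m + 1)" using elim m(2) by linarith
    then have "N \<le> m + 1" using power_less_imp_less_exp[of "2::nat" N "m + 1"] by simp
    then have "\<bar>S n\<bar> < real (2 ^ (m + 1)) powr a" using N m(2) by blast
    also have "\<dots> \<le> (2 * real n) powr a"
    proof (rule powr_mono2)
      have "real (2 ^ m) \<le> real n" using m(1) by (intro of_nat_mono) simp
      then show "real (2 ^ (m + 1)) \<le> 2 * real n" by simp
    qed (use a in auto)
    finally show ?case by simp
  qed
qed

text \<open>The martingale property is stated as orthogonality to every square-integrable
  \<open>Z\<close> known at time \<open>n\<close>, which is all that the computation of second
  moments uses. The increment \<open>D n\<close> becomes known at time \<open>Suc n\<close>.\<close>

locale L2_martingale_differences = prob_space M for M :: "'w measure" +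
  fixes F :: "nat \<Rightarrow> 'w measure" and D :: "nat \<Rightarrow> 'w \<Rightarrow> real" and c :: real
  assumes subalg: "subalgebra M (F n)" and filtration: "subalgebra (F (Suc n)) (F n)"
    and D_adapted: "D n \<in> borel_measurable (F (Suc n))"
    and D_sq: "integrable M (\<lambda>\<omega>. (D n \<omega>)\<^sup>2)" "(\<integral>\<omega>. (D n \<omega>)\<^sup>2 \<partial>M) \<le> c"
    and D_orthogonal: "Z \<in> borel_measurable (F n) \<Longrightarrow> integrable M (\<lambda>\<omega>. (Z \<omega>)\<^sup>2) \<Longrightarrow>
      (\<integral>\<omega>. Z \<omega> * D n \<omega> \<partial>M) = 0"
begin

lemma stopped_sum_adapted: "stopped_sum l D n \<in> borel_measurable (F n)"
proof (induction n)
  case (Suc n)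
  have [measurable]: "stopped_sum l D n \<in> borel_measurable (F (Suc n))"
    by (rule measurable_from_subalg[OF filtration Suc])
  note D_adapted[measurable]
  show ?case unfolding stopped_sum.simps by measurable
qed simp

lemma D_measurable[measurable]: "D n \<in> borel_measurable M"
  by (rule measurable_from_subalg[OF subalg D_adapted])

lemma stopped_sum_measurable[measurable]: "stopped_sum l D n \<in> borel_measurable M"
  by (rule measurable_from_subalg[OF subalg stopped_sum_adapted])

lemma stopped_sum_sq:
  "integrable M (\<lambda>\<omega>. (stopped_sum l D n \<omega>)\<^sup>2) \<and> (\<integral>\<omega>. (stopped_sum l D n \<omega>)\<^sup>2 \<partial>M) \<le> real n * c"
proof (induction n)
  case (Suc n)
  let ?T = "stopped_sum l D n"
  \<comment> \<open>\<open>Z\<close> vanishes once the sum is frozen, so the cross term can be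
    written with the full \<open>D n\<close>; as \<open>Z\<close> is known at time \<open>n\<close>,
    orthogonality removes it.\<close>
  define Z where "Z \<omega> = (if \<bar>?T \<omega>\<bar> < l then ?T \<omega> else 0)" for \<omega>
  define D' where "D' \<omega> = (if \<bar>?T \<omega>\<bar> < l then D n \<omega> else 0)" for \<omega>
  note stopped_sum_adapted[measurable]
  have ZF: "Z \<in> borel_measurable (F n)" unfolding Z_def by measurable
  have [measurable]: "Z \<in> borel_measurable M" "D' \<in> borel_measurable M"
    unfolding Z_def D'_def by measurable
  have iT: "integrable M (\<lambda>\<omega>. (?T \<omega>)\<^sup>2)" using Suc by simp
  have iZ: "integrable M (\<lambda>\<omega>. (Z \<omega>)\<^sup>2)"
    by (rule Bochner_Integration.integrable_bound[OF iT]) (auto simp: Z_def)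
  have iD': "integrable M (\<lambda>\<omega>. (D' \<omega>)\<^sup>2)"
    by (rule Bochner_Integration.integrable_bound[OF D_sq(1)[of n]]) (auto simp: D'_def)
  have iZD: "integrable M (\<lambda>\<omega>. Z \<omega> * D n \<omega>)"
    by (rule integrable_mult_of_sq) (use iZ D_sq(1) in auto)
  have eq: "(stopped_sum l D (Suc n) \<omega>)\<^sup>2 = (?T \<omega>)\<^sup>2 + 2 * (Z \<omega> * D n \<omega>) + (D' \<omega>)\<^sup>2" for \<omega>
    by (simp add: Z_def D'_def power2_eq_square algebra_simps)
  have "(\<integral>\<omega>. (D' \<omega>)\<^sup>2 \<partial>M) \<le> (\<integral>\<omega>. (D n \<omega>)\<^sup>2 \<partial>M)"
    by (intro integral_mono iD' D_sq) (simp add: D'_def)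
  then have le: "(\<integral>\<omega>. (D' \<omega>)\<^sup>2 \<partial>M) \<le> c" using D_sq(2)[of n] by simp
  have "(\<integral>\<omega>. (stopped_sum l D (Suc n) \<omega>)\<^sup>2 \<partial>M) = (\<integral>\<omega>. (?T \<omega>)\<^sup>2 \<partial>M) + (\<integral>\<omega>. (D' \<omega>)\<^sup>2 \<partial>M)"
    unfolding eq using iT iZD iD' D_orthogonal[OF ZF iZ] by simp
  then show ?case
    using Suc le iT iZD iD' unfolding eq by (auto simp: distrib_right)
qed simp

lemma maximal_inequality:
  assumes l: "0 < l"
  shows "prob {\<omega>\<in>space M. l \<le> \<bar>stopped_sum l D n \<omega>\<bar>} \<le> real n * c / l\<^sup>2"
proof -
  let ?A = "{\<omega>\<in>space M. l \<le> \<bar>stopped_sum l D n \<omega>\<bar>}"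
  have int: "integrable M (\<lambda>\<omega>. l\<^sup>2 * indicator ?A \<omega>)"
    by (intro integrable_mult_right integrable_real_indicator) (auto simp: emeasure_eq_measure)
  have "l\<^sup>2 * prob ?A = (\<integral>\<omega>. l\<^sup>2 * indicator ?A \<omega> \<partial>M)" by simp
  also have "\<dots> \<le> (\<integral>\<omega>. (stopped_sum l D n \<omega>)\<^sup>2 \<partial>M)"
  proof (rule integral_mono)
    fix \<omega> assume "\<omega> \<in> space M"
    show "l\<^sup>2 * indicator ?A \<omega> \<le> (stopped_sum l D n \<omega>)\<^sup>2"
      using l abs_le_square_iff[of l "stopped_sum l D n \<omega>"] by (auto simp: indicator_def)
  qed (use int stopped_sum_sq in auto)
  also have "\<dots> \<le> real n * c" using stopped_sum_sq by blast
  finally show ?thesis using l by (simp add: pos_le_divide_eq mult.commute)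
qed

lemma strong_law:
  assumes e: "0 < e"
  shows "AE \<omega> in M. (\<lambda>n. (\<Sum>j<n. D j \<omega>) / real n powr (1 / 2 + e)) \<longlonglongrightarrow> 0"
proof -
  \<comment> \<open>The surplus \<open>e\<close> is split: one half makes the probabilities decay
    like \<open>(2 powr (- e)) ^ k\<close> for Borel-Cantelli, the other half remains as
    \<open>real n powr (- (e / 2))\<close>.\<close>
  define a where "a = 1 / 2 + e / 2"
  define l where "l k = real (2 ^ k) powr a" for k :: nat
  define A where "A k = {\<omega>\<in>space M. l k \<le> \<bar>stopped_sum (l k) D (2 ^ k) \<omega>\<bar>}" for k
  have l_pos: "0 < l k" for k by (simp add: l_def)
  have [measurable]: "A k \<in> sets M" for k unfolding A_def by measurable
  have A_le: "prob (A k) \<le> c * (2 powr (- e)) ^ k" for k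
  proof -
    have "prob (A k) \<le> real (2 ^ k) * c / (l k)\<^sup>2"
      unfolding A_def by (rule maximal_inequality[OF l_pos])
    also have "\<dots> = c * (real (2 ^ k) powr 1 / real (2 ^ k) powr (2 * a))"
      by (simp add: l_def power2_eq_square powr_add[symmetric])
    also have "\<dots> = c * real (2 ^ k) powr (- e)"
      unfolding powr_diff[symmetric] by (simp add: a_def)
    also have "real (2 ^ k) powr (- e) = (2 powr (- e)) ^ k"
      by (simp add: powr_realpow[symmetric] powr_powr mult.commute)
    finally show ?thesis .
  qed
  have "summable (\<lambda>k. prob (A k))"
  proof (rule summable_comparison_test')
    have "2 powr (- e) < (1 :: real)" using e by (simp add: powr_less_one)
    then show "summable (\<lambda>k. c * (2 powr (- e)) ^ k)" by (intro summable_mult summable_geometric) simp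
  qed (use A_le in simp)
  then have "AE \<omega> in M. \<forall>\<^sub>F k in sequentially. \<omega> \<in> space M - A k"
    by (intro borel_cantelli_AE1) (auto simp: emeasure_eq_measure)
  then show ?thesis
  proof eventually_elim
    case (elim \<omega>)
    let ?S = "\<lambda>n. \<Sum>j<n. D j \<omega>"
    have "\<forall>\<^sub>F k in sequentially. \<forall>n\<le>2 ^ k. \<bar>?S n\<bar> < real (2 ^ k) powr a"
      using elim
    proof eventually_elim
      case (elim k)
      then show ?case
        using stopped_sum_maximal[where l="l k" and D=D and \<omega>=\<omega> and N="2 ^ k"] by (force simp: A_def l_def not_less[symmetric])
    qed
    then have "\<forall>\<^sub>F n in sequentially. \<bar>?S n\<bar> \<le> (2 * real n) powr a"
      by (rule eventually_powr_of_dyadic[rotated]) (use e in \<open>simp add: a_def\<close>)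
    then have "\<forall>\<^sub>F n in sequentially. norm (?S n / real n powr (1 / 2 + e)) \<le> 2 powr a * real n powr (- (e / 2))"
      using eventually_gt_at_top[of 0]
    proof eventually_elim
      case (elim n)
      then have "norm (?S n / real n powr (1 / 2 + e)) \<le> (2 * real n) powr a / real n powr (1 / 2 + e)"
        by (simp add: divide_right_mono)
      also have "\<dots> = 2 powr a * real n powr (a - (1 / 2 + e))"
        by (simp add: powr_mult powr_diff)
      also have "a - (1 / 2 + e) = - (e / 2)" by (simp add: a_def)
      finally show ?case .
    qed
    moreover have "(\<lambda>n. 2 powr a * real n powr (- (e / 2))) \<longlonglongrightarrow> 0"
    proof -
      have "(\<lambda>n. real n powr (- (e / 2))) \<longlonglongrightarrow> 0"
        by (rule tendsto_neg_powr) (use e filterlim_real_sequentially in auto)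
      from tendsto_mult_left[OF this, of "2 powr a"] show ?thesis by simp
    qed
    ultimately show ?case by (rule Lim_null_comparison)
  qed
qed

end

section \<open>Joint law and adaptation times of the chain\<close>

text \<open>Pushing \<open>k x\<close> forward along \<open>Pair x\<close> moves the dependence of
  the integrand on \<open>x\<close> into the measure, leaving a fixed integrand.\<close>

lemma integral_measurable_kernel:
  fixes u :: "'a \<Rightarrow> 'b \<Rightarrow> real"
  assumes u: "(\<lambda>(x, y). u x y) \<in> borel_measurable (M \<Otimes>\<^sub>M N)"
    and k[measurable]: "k \<in> M \<rightarrow>\<^sub>M subprob_algebra N"
  shows "(\<lambda>x. \<integral>y. u x y \<partial>k x) \<in> borel_measurable M"
proof -
  have "(\<lambda>x. \<integral>z. (\<lambda>(x, y). u x y) z \<partial>distr (k x) (M \<Otimes>\<^sub>M N) (\<lambda>y. (x, y))) \<in> borel_measurable M"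
    by (rule measurable_compose[OF measurable_distr2[OF _ k] integral_measurable_subprob_algebra[OF u]]) simp
  moreover have "(\<integral>z. (\<lambda>(x, y). u x y) z \<partial>distr (k x) (M \<Otimes>\<^sub>M N) (\<lambda>y. (x, y))) = (\<integral>y. u x y \<partial>k x)"
    if x: "x \<in> space M" for x
  proof (subst integral_distr[OF _ u])
    show "(\<lambda>y. (x, y)) \<in> k x \<rightarrow>\<^sub>M M \<Otimes>\<^sub>M N"
      using x sets_kernel[OF k x] by (simp cong: measurable_cong_sets)
  qed simp
  ultimately show ?thesis by (simp cong: measurable_cong)
qed

section \<open>Joint measurability in parameter and state\<close>

context air_setting
begin

lemma kernel_jointly_measurable: "(\<lambda>(\<gamma>, y). P \<gamma> y) \<in> I \<Otimes>\<^sub>M borel \<rightarrow>\<^sub>M prob_algebra borel"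
proof (rule measurable_prob_algebra_generated[where \<Omega>=UNIV and G="sets borel"])
  show "sets borel = sigma_sets UNIV (sets (borel :: ('x \<times> 'p) measure))"
    using sets.sigma_sets_eq[of "borel :: ('x \<times> 'p) measure"] by simp
  show "Int_stable (sets (borel :: ('x \<times> 'p) measure))" by (rule sets.Int_stable)
  fix a assume "a \<in> space (I \<Otimes>\<^sub>M (borel :: ('x \<times> 'p) measure))"
  then obtain \<gamma> y where a: "a = (\<gamma>, y)" "\<gamma> \<in> space I" by (auto simp: space_pair_measure)
  with measurable_space[OF kernel[OF a(2)], of y]
  show "prob_space (case a of (\<gamma>, y) \<Rightarrow> P \<gamma> y)" "sets (case a of (\<gamma>, y) \<Rightarrow> P \<gamma> y) = sets borel"
    by (simp_all add: space_prob_algebra)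
next
  fix A :: "('x \<times> 'p) set" assume "A \<in> sets borel"
  from measurable_compose[OF measurable_pair_swap' jointly_measurable[OF this]]
  show "(\<lambda>a. emeasure (case a of (\<gamma>, y) \<Rightarrow> P \<gamma> y) A) \<in> borel_measurable (I \<Otimes>\<^sub>M borel)"
    by (simp add: case_prod_beta')
qed simp

text \<open>Needed because the parameter is itself random along the chain. In the inductive step
  both integrand and kernel depend on \<gamma>.\<close>

lemma kernel_iterate_jointly_measurable:
  assumes h: "h \<in> borel_measurable borel"
  shows "(\<lambda>(\<gamma>, y). kernel_iterate (P \<gamma>) h k y) \<in> borel_measurable (I \<Otimes>\<^sub>M borel)"
proof (induction k)
  case 0
  then show ?case using h by simp
next
  case (Suc k)
  have [measurable]: "(\<lambda>x. kernel_iterate (P (fst x)) h k (snd x)) \<in> borel_measurable (I \<Otimes>\<^sub>M borel)"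
    using Suc by (simp add: case_prod_beta')
  have "(\<lambda>x. \<integral>z. kernel_iterate (P (fst x)) h k z \<partial>(case x of (\<gamma>, y) \<Rightarrow> P \<gamma> y)) \<in> borel_measurable (I \<Otimes>\<^sub>M borel)"
  proof (rule integral_measurable_kernel)
    show "(\<lambda>(\<gamma>, y). P \<gamma> y) \<in> I \<Otimes>\<^sub>M borel \<rightarrow>\<^sub>M subprob_algebra borel"
      by (rule measurable_prob_algebraD[OF kernel_jointly_measurable])
    have "(\<lambda>w. kernel_iterate (P (fst (fst (fst w), snd w))) h k (snd (fst (fst w), snd w)))
        \<in> borel_measurable ((I \<Otimes>\<^sub>M borel) \<Otimes>\<^sub>M (borel :: ('x \<times> 'p) measure))"
      by measurable
    then show "(\<lambda>(x, z). kernel_iterate (P (fst x)) h k z)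
        \<in> borel_measurable ((I \<Otimes>\<^sub>M borel) \<Otimes>\<^sub>M (borel :: ('x \<times> 'p) measure))"
      by (simp add: case_prod_beta')
  qed
  then show ?case by (simp add: case_prod_beta')
qed

lemma poisson_solution_jointly_measurable:
  assumes h: "h \<in> borel_measurable borel"
  shows "(\<lambda>(\<gamma>, y). poisson_solution (P \<gamma>) h c y) \<in> borel_measurable (I \<Otimes>\<^sub>M borel)"
proof -
  have [measurable]: "(\<lambda>x. kernel_iterate (P (fst x)) h k (snd x)) \<in> borel_measurable (I \<Otimes>\<^sub>M borel)" for k
    using kernel_iterate_jointly_measurable[OF h, of k] by (simp add: case_prod_beta')
  show ?thesis unfolding poisson_solution_def case_prod_beta' by measurable
qed

lemma measurable_fst_borel: "(fst :: 'x \<times> 'p \<Rightarrow> 'x) \<in> borel_measurable borel"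
  by (intro borel_measurable_continuous_onI continuous_intros)

text \<open>Every \<open>\<pi> \<gamma>\<close> projects to \<open>\<nu>\<close>, so kernels with
  different invariant laws all centre \<open>f\<close> by the same constant. The parameter may
  therefore keep moving without creating a bias.\<close>

lemma integral_pi_fst:
  assumes \<gamma>: "\<gamma> \<in> space I" and f: "f \<in> borel_measurable borel"
  shows "(\<integral>y. f (fst y) \<partial>\<pi> \<gamma>) = (\<integral>x. f x \<partial>\<nu> :: real)"
proof -
  have m: "fst \<in> \<pi> \<gamma> \<rightarrow>\<^sub>M borel"
    using measurable_fst_borel sets_pi[OF \<gamma>] by (simp cong: measurable_cong_sets)
  have "distr (\<pi> \<gamma>) borel fst = \<nu>"
  proof (rule measure_eqI)
    fix B :: "'x set" assume "B \<in> sets (distr (\<pi> \<gamma>) borel fst)"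
    moreover have "fst -` B \<inter> space (\<pi> \<gamma>) = B \<times> UNIV"
      using sets_eq_imp_space_eq[OF sets_pi[OF \<gamma>]] by auto
    ultimately show "emeasure (distr (\<pi> \<gamma>) borel fst) B = emeasure \<nu> B"
      using marginal_pi[OF \<gamma>] m by (simp add: emeasure_distr)
  qed (simp add: sets_nu)
  then show ?thesis
    using integral_distr[OF m f] by simp
qed

end

section \<open>The law of the next state given the history\<close>

context air_chain
begin

abbreviation "history \<equiv> history_algebra M I Y \<Gamma>"

lemma space_history[simp]: "space (history n) = space M"
  unfolding history_algebra_def by (rule space_measure_of) auto

lemma sets_history: "sets (history n) = sigma_sets (space M)
     ({Y i -` A \<inter> space M | i A. i \<le> n \<and> A \<in> sets borel} \<union>
      {\<Gamma> i -` B \<inter> space M | i B. i \<le> n \<and> B \<in> sets I})"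
  unfolding history_algebra_def by (rule sets_measure_of) auto

lemma history_subalgebra: "subalgebra M (history n)"
  unfolding subalgebra_def sets_history
  by (auto intro!: sets.sigma_sets_subset measurable_sets[OF measurable_Y] measurable_sets[OF measurable_Gamma])

lemma history_filtration: "subalgebra (history (Suc n)) (history n)"
  unfolding subalgebra_def sets_history
proof (intro conjI sigma_sets_mono' Un_mono)
qed (auto; metis le_SucI)+

lemma Y_adapted: "i \<le> n \<Longrightarrow> Y i \<in> history n \<rightarrow>\<^sub>M borel"
  using measurable_space[OF measurable_Y]
  by (intro measurableI) (auto simp: sets_history intro!: sigma_sets.Basic)

lemma Gamma_adapted: "i \<le> n \<Longrightarrow> \<Gamma> i \<in> history n \<rightarrow>\<^sub>M I"
  using measurable_space[OF measurable_Gamma]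
  by (intro measurableI) (auto simp: sets_history intro!: sigma_sets.Basic)

definition next_law where "next_law n \<omega> = P (\<Gamma> n \<omega>) (Y n \<omega>)"

lemma next_law_adapted: "next_law n \<in> history n \<rightarrow>\<^sub>M prob_algebra borel"
proof -
  have "(\<lambda>\<omega>. (\<Gamma> n \<omega>, Y n \<omega>)) \<in> history n \<rightarrow>\<^sub>M I \<Otimes>\<^sub>M borel"
    using Y_adapted[of n n] Gamma_adapted[of n n] by measurable
  from measurable_compose[OF this kernel_jointly_measurable]
  show ?thesis by (simp add: next_law_def[abs_def])
qed

lemma next_law_measurable[measurable]: "next_law n \<in> M \<rightarrow>\<^sub>M prob_algebra borel"
  by (rule measurable_from_subalg[OF history_subalgebra next_law_adapted])

lemma prob_next_law: "\<omega> \<in> space M \<Longrightarrow> prob_space (next_law n \<omega>)"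
  and sets_next_law: "\<omega> \<in> space M \<Longrightarrow> sets (next_law n \<omega>) = sets borel"
  using measurable_space[OF next_law_measurable, of \<omega> n] by (simp_all add: space_prob_algebra)

text \<open>The transition hypothesis integrated over a past event; this is the joint law on
  rectangles.\<close>

lemma emeasure_transition:
  assumes A: "A \<in> sets (history n)" and B: "B \<in> sets borel"
  shows "emeasure M (A \<inter> {\<omega>\<in>space M. Y (Suc n) \<omega> \<in> B}) = (\<integral>\<^sup>+\<omega>. indicator A \<omega> * emeasure (next_law n \<omega>) B \<partial>M)"
proof -
  interpret finite_measure_subalgebra M "history n"
    by unfold_locales (rule history_subalgebra)
  note measurable_Y[measurable] B[measurable]
  have AM[measurable]: "A \<in> sets M" using A history_subalgebra[of n] by (auto simp: subalgebra_def)
  let ?E = "{\<omega>\<in>space M. Y (Suc n) \<omega> \<in> B}"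
  have pm: "(\<lambda>\<omega>. measure (next_law n \<omega>) B) \<in> borel_measurable M"
    by measurable
  have i: "integrable M (indicator ?E :: 'w \<Rightarrow> real)"
    by (intro integrable_real_indicator) (auto simp: emeasure_eq_measure)
  have "measure M (A \<inter> ?E) = (\<integral>\<omega>\<in>A. indicator ?E \<omega> \<partial>M)"
    by (simp add: set_lebesgue_integral_def indicator_inter_arith[symmetric])
  also have "\<dots> = (\<integral>\<omega>\<in>A. real_cond_exp M (history n) (indicator ?E) \<omega> \<partial>M)"
    by (rule real_cond_exp_intA[OF i A])
  also have "\<dots> = (\<integral>\<omega>. indicator A \<omega> * measure (next_law n \<omega>) B \<partial>M)"
    unfolding set_lebesgue_integral_def
    by (rule integral_cong_AE) (use transition[OF B, of n] pm in \<open>auto simp: next_law_def\<close>)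
  finally have "ennreal (measure M (A \<inter> ?E)) = ennreal (\<integral>\<omega>. indicator A \<omega> * measure (next_law n \<omega>) B \<partial>M)"
    by simp
  also have "\<dots> = (\<integral>\<^sup>+\<omega>. ennreal (indicator A \<omega> * measure (next_law n \<omega>) B) \<partial>M)"
  proof (rule nn_integral_eq_integral[symmetric])
    show "integrable M (\<lambda>\<omega>. indicator A \<omega> * measure (next_law n \<omega>) B)"
    proof (rule integrable_const_bound[where B=1])
      show "AE \<omega> in M. norm (indicator A \<omega> * measure (next_law n \<omega>) B) \<le> 1"
        using prob_next_law by (auto intro!: AE_I2 simp: indicator_def prob_space.prob_le_1)
    qed (use pm in measurable)
  qed simp
  also have "\<dots> = (\<integral>\<^sup>+\<omega>. indicator A \<omega> * emeasure (next_law n \<omega>) B \<partial>M)"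
    using prob_next_law
    by (intro nn_integral_cong)
      (auto simp: indicator_def finite_measure.emeasure_eq_measure prob_space.finite_measure)
  finally show ?thesis by (simp add: emeasure_eq_measure)
qed

text \<open>The first coordinate is \<omega> itself, observed only through the history
  \<sigma>-algebra, so that any functional of the past can be handled without listing the earlier
  variables. Rectangles generate the product and are stable under intersection.\<close>

lemma joint_law:
  "distr M (history n \<Otimes>\<^sub>M borel) (\<lambda>\<omega>. (\<omega>, Y (Suc n) \<omega>))
    = M \<bind> (\<lambda>\<omega>. distr (next_law n \<omega>) (history n \<Otimes>\<^sub>M borel) (Pair \<omega>))" (is "?N1 = M \<bind> ?k")
  and joint_kernel_measurable:
  "(\<lambda>\<omega>. distr (next_law n \<omega>) (history n \<Otimes>\<^sub>M borel) (Pair \<omega>)) \<in> M \<rightarrow>\<^sub>M prob_algebra (history n \<Otimes>\<^sub>M borel)"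
proof -
  have id: "(\<lambda>\<omega>. \<omega>) \<in> M \<rightarrow>\<^sub>M history n"
    by (rule measurable_from_subalg[OF history_subalgebra measurable_ident_sets[OF refl]])
  have pm: "(\<lambda>\<omega>. (\<omega>, Y (Suc n) \<omega>)) \<in> M \<rightarrow>\<^sub>M history n \<Otimes>\<^sub>M borel"
    using id measurable_Y by measurable
  have Pm: "Pair \<omega> \<in> next_law n \<omega> \<rightarrow>\<^sub>M history n \<Otimes>\<^sub>M borel" if "\<omega> \<in> space M" for \<omega>
    using that sets_next_law[OF that] by (simp cong: measurable_cong_sets)
  have "(\<lambda>(\<omega>, y). (\<omega>, y)) \<in> M \<Otimes>\<^sub>M borel \<rightarrow>\<^sub>M history n \<Otimes>\<^sub>M (borel :: ('x \<times> 'p) measure)"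
    using measurable_compose[OF measurable_fst id] by measurable
  then show k: "?k \<in> M \<rightarrow>\<^sub>M prob_algebra (history n \<Otimes>\<^sub>M borel)"
    by (intro measurable_distr_prob_space2[OF next_law_measurable]) simp
  let ?E = "{a \<times> b | a b. a \<in> sets (history n) \<and> b \<in> sets (borel :: ('x \<times> 'p) measure)}"
  have sb: "sets (M \<bind> ?k) = sets (history n \<Otimes>\<^sub>M borel)"
    by (rule sets_bind[OF sets_kernel[OF measurable_prob_algebraD[OF k]] not_empty])
  show "?N1 = M \<bind> ?k"
  proof (rule measure_eqI_generator_eq[where E="?E" and \<Omega>="space (history n) \<times> space borel"
        and A="\<lambda>_. space (history n) \<times> space borel"])
    show "Int_stable ?E" by (rule Int_stable_pair_measure_generator)
    show "?E \<subseteq> Pow (space (history n) \<times> space borel)" by (rule pair_measure_closed)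
    show "sets ?N1 = sigma_sets (space (history n) \<times> space borel) ?E"
      "sets (M \<bind> ?k) = sigma_sets (space (history n) \<times> space borel) ?E"
      unfolding sb by (simp_all add: sets_pair_measure)
    show "range (\<lambda>_. space (history n) \<times> space borel) \<subseteq> ?E" by blast
    interpret N1: prob_space ?N1 by (rule prob_space_distr[OF pm])
    show "emeasure ?N1 (space (history n) \<times> space borel) \<noteq> \<infinity>" by simp
    fix X assume "X \<in> ?E"
    then obtain A B where X: "X = A \<times> B" and A: "A \<in> sets (history n)" and B: "B \<in> sets borel"
      by blast
    have XS: "X \<in> sets (history n \<Otimes>\<^sub>M borel)" using A B X by simp
    have AM: "A \<subseteq> space M" using sets.sets_into_space[OF A] by simp
    have "emeasure ?N1 X = emeasure M (A \<inter> {\<omega>\<in>space M. Y (Suc n) \<omega> \<in> B})"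
      using AM by (subst emeasure_distr[OF pm XS]) (auto simp: X intro!: arg_cong[of _ _ "emeasure M"])
    also have "\<dots> = (\<integral>\<^sup>+\<omega>. indicator A \<omega> * emeasure (next_law n \<omega>) B \<partial>M)"
      by (rule emeasure_transition[OF A B])
    also have "\<dots> = (\<integral>\<^sup>+\<omega>. emeasure (?k \<omega>) X \<partial>M)"
    proof (rule nn_integral_cong)
      fix \<omega> assume w: "\<omega> \<in> space M"
      have "Pair \<omega> -` X \<inter> space (next_law n \<omega>) = (if \<omega> \<in> A then B else {})"
        using sets_eq_imp_space_eq[OF sets_next_law[OF w]] by (auto simp: X)
      then show "indicator A \<omega> * emeasure (next_law n \<omega>) B = emeasure (?k \<omega>) X"
        by (simp add: emeasure_distr[OF Pm[OF w] XS] indicator_def)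
    qed
    also have "\<dots> = emeasure (M \<bind> ?k) X"
      by (rule emeasure_bind[symmetric, OF not_empty measurable_prob_algebraD[OF k] XS])
    finally show "emeasure ?N1 X = emeasure (M \<bind> ?k) X" .
  qed auto
qed

text \<open>An integrated Markov property: with the past held fixed, the next state may be replaced
  by an average over \<open>next_law\<close>. It takes the place of conditional expectations from
  here on.\<close>

lemma
  fixes \<Phi> :: "'w \<times> 'x \<times> 'p \<Rightarrow> real"
  assumes \<Phi>: "\<Phi> \<in> borel_measurable (history n \<Otimes>\<^sub>M borel)"
  shows nn_integral_transition:
    "(\<integral>\<^sup>+\<omega>. ennreal (\<Phi> (\<omega>, Y (Suc n) \<omega>)) \<partial>M) = (\<integral>\<^sup>+\<omega>. \<integral>\<^sup>+y. ennreal (\<Phi> (\<omega>, y)) \<partial>next_law n \<omega> \<partial>M)"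
    and integral_transition: "integrable M (\<lambda>\<omega>. \<Phi> (\<omega>, Y (Suc n) \<omega>)) \<Longrightarrow>
    (\<integral>\<omega>. \<Phi> (\<omega>, Y (Suc n) \<omega>) \<partial>M) = (\<integral>\<omega>. \<integral>y. \<Phi> (\<omega>, y) \<partial>next_law n \<omega> \<partial>M)"
proof -
  let ?k = "\<lambda>\<omega>. distr (next_law n \<omega>) (history n \<Otimes>\<^sub>M borel) (Pair \<omega>)"
  have id: "(\<lambda>\<omega>. \<omega>) \<in> M \<rightarrow>\<^sub>M history n"
    by (rule measurable_from_subalg[OF history_subalgebra measurable_ident_sets[OF refl]])
  have pm: "(\<lambda>\<omega>. (\<omega>, Y (Suc n) \<omega>)) \<in> M \<rightarrow>\<^sub>M history n \<Otimes>\<^sub>M borel"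
    using id measurable_Y by measurable
  have Pm: "Pair \<omega> \<in> next_law n \<omega> \<rightarrow>\<^sub>M history n \<Otimes>\<^sub>M borel" if "\<omega> \<in> space M" for \<omega>
    using that sets_next_law[OF that] by (simp cong: measurable_cong_sets)
  note k = measurable_prob_algebraD[OF joint_kernel_measurable]
  have \<Phi>': "(\<lambda>z. ennreal (\<Phi> z)) \<in> borel_measurable (history n \<Otimes>\<^sub>M borel)" using \<Phi> by measurable
  have "(\<integral>\<^sup>+\<omega>. ennreal (\<Phi> (\<omega>, Y (Suc n) \<omega>)) \<partial>M) = (\<integral>\<^sup>+z. ennreal (\<Phi> z) \<partial>(M \<bind> ?k))"
    unfolding joint_law[symmetric] using \<Phi>' by (subst nn_integral_distr[OF pm]) simp_all
  also have "\<dots> = (\<integral>\<^sup>+\<omega>. \<integral>\<^sup>+z. ennreal (\<Phi> z) \<partial>?k \<omega> \<partial>M)"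
    by (rule nn_integral_bind[OF \<Phi>' k])
  also have "\<dots> = (\<integral>\<^sup>+\<omega>. \<integral>\<^sup>+y. ennreal (\<Phi> (\<omega>, y)) \<partial>next_law n \<omega> \<partial>M)"
    using \<Phi>' by (intro nn_integral_cong) (simp add: nn_integral_distr[OF Pm])
  finally show "(\<integral>\<^sup>+\<omega>. ennreal (\<Phi> (\<omega>, Y (Suc n) \<omega>)) \<partial>M) = (\<integral>\<^sup>+\<omega>. \<integral>\<^sup>+y. ennreal (\<Phi> (\<omega>, y)) \<partial>next_law n \<omega> \<partial>M)" .
  assume int: "integrable M (\<lambda>\<omega>. \<Phi> (\<omega>, Y (Suc n) \<omega>))"
  have "integrable (M \<bind> ?k) \<Phi>"
    unfolding joint_law[symmetric] by (subst integrable_distr_eq[OF pm \<Phi>]) (rule int)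
  note b = integral_bind_iterated[OF \<Phi> k not_empty this]
  have "(\<integral>\<omega>. \<Phi> (\<omega>, Y (Suc n) \<omega>) \<partial>M) = (\<integral>z. \<Phi> z \<partial>(M \<bind> ?k))"
    unfolding joint_law[symmetric] by (rule integral_distr[OF pm \<Phi>, symmetric])
  also have "\<dots> = (\<integral>\<omega>. \<integral>y. \<Phi> (\<omega>, y) \<partial>next_law n \<omega> \<partial>M)"
    unfolding b by (intro Bochner_Integration.integral_cong refl integral_distr[OF Pm \<Phi>])
  finally show "(\<integral>\<omega>. \<Phi> (\<omega>, Y (Suc n) \<omega>) \<partial>M) = (\<integral>\<omega>. \<integral>y. \<Phi> (\<omega>, y) \<partial>next_law n \<omega> \<partial>M)" .
qed

section \<open>Frequency of the adaptation times\<close>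

lemma air_time_ge:
  "(real m / 2) powr (1 + \<beta>) \<le> real (air_time \<beta> m)"
proof (cases "m = 0")
  case False
  \<comment> \<open>Only the upper half of the lags is kept: from this rounding on there are at
    least \<open>m / 2\<close> indices, each at least \<open>m / 2\<close>.\<close>
  let ?k = "(m + 1) div 2"
  have k: "1 \<le> ?k" "real m / 2 \<le> real ?k" using False by linarith+
  have "(real m / 2) powr (1 + \<beta>) = real m / 2 * (real m / 2) powr \<beta>"
    using False by (simp add: powr_add)
  also have "\<dots> \<le> real (card {?k..m}) * (real m / 2) powr \<beta>"
  proof (intro mult_right_mono)
    have "m \<le> 2 * card {?k..m}" by simp
    then show "real m / 2 \<le> real (card {?k..m})" by linarith
  qed simp
  also have "\<dots> = (\<Sum>j\<in>{?k..m}. (real m / 2) powr \<beta>)" by simp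
  also have "\<dots> \<le> (\<Sum>j\<in>{?k..m}. real (air_lag \<beta> j))"
  proof (rule sum_mono)
    fix j assume "j \<in> {?k..m}"
    then have "real ?k \<le> real j" by simp
    then have "real m / 2 \<le> real j" using k(2) by linarith
    then have "(real m / 2) powr \<beta> \<le> real j powr \<beta>"
      using beta_pos by (intro powr_mono2) auto
    also have "\<dots> \<le> real (air_lag \<beta> j)"
      unfolding air_lag_def by linarith
    finally show "(real m / 2) powr \<beta> \<le> real (air_lag \<beta> j)" .
  qed
  also have "\<dots> \<le> (\<Sum>j\<in>{1..m}. real (air_lag \<beta> j))"
    using k(1) by (intro sum_mono2) auto
  also have "\<dots> = real (air_time \<beta> m)" by (simp add: air_time_def)
  finally show ?thesis .
qed simp

lemma air_time_le_imp:
  assumes "air_time \<beta> m \<le> n"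
  shows "real m \<le> 2 * real n powr (1 / (1 + \<beta>))"
proof -
  have "(real m / 2) powr (1 + \<beta>) \<le> real n"
    using air_time_ge[of m] assms by linarith
  then have "((real m / 2) powr (1 + \<beta>)) powr (1 / (1 + \<beta>)) \<le> real n powr (1 / (1 + \<beta>))"
    using beta_pos by (intro powr_mono2) auto
  then show ?thesis using beta_pos by (simp add: powr_powr)
qed

lemma air_time_bracket: "\<exists>m. air_time \<beta> m \<le> i \<and> i < air_time \<beta> (Suc m)"
proof -
  have ex: "\<exists>m. i < air_time \<beta> m"
  proof -
    obtain m where m: "2 * real i powr (1 / (1 + \<beta>)) < real m" using reals_Archimedean2 by blast
    then have "i < air_time \<beta> m" using air_time_le_imp[of m i] by linarith
    then show ?thesis ..
  qed
  \<comment> \<open>\<open>air_time \<beta> 0 = 0\<close> rules out 0 as the least index, and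
    minimality gives the lower bracket for its predecessor.\<close>
  define m where "m = (LEAST m. i < air_time \<beta> m)"
  have m: "i < air_time \<beta> m" unfolding m_def by (rule LeastI_ex[OF ex])
  then obtain m' where m': "m = Suc m'" by (cases m) (auto simp: air_time_def)
  have "\<not> i < air_time \<beta> m'" 
  proof -
    have "m' < m" using m' by simp
    then show ?thesis unfolding m_def by (rule not_less_Least)
  qed
  then show ?thesis using m m' by (intro exI[of _ m']) simp
qed

lemma adaptation_count:
  assumes w: "\<omega> \<in> space M"
  shows "real (card {j\<in>{1..n}. \<Gamma> j \<omega> \<noteq> \<Gamma> (j - 1) \<omega>}) \<le> 2 * real n powr (1 / (1 + \<beta>))"
proof -
  let ?r = "2 * real n powr (1 / (1 + \<beta>))"
  let ?R = "{1..nat \<lfloor>?r\<rfloor>}"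
  have "{j\<in>{1..n}. \<Gamma> j \<omega> \<noteq> \<Gamma> (j - 1) \<omega>} \<subseteq> air_time \<beta> ` ?R"
  proof
    fix j assume j: "j \<in> {j\<in>{1..n}. \<Gamma> j \<omega> \<noteq> \<Gamma> (j - 1) \<omega>}"
    obtain m where m: "air_time \<beta> m \<le> j - 1" "j - 1 < air_time \<beta> (Suc m)"
      using air_time_bracket by blast
    \<comment> \<open>A change at \<open>j\<close> means that \<open>j - 1\<close> and
      \<open>j\<close> lie in different adaptation intervals, hence \<open>j\<close> is the left end
      of the next one.\<close>
    have "\<not> j < air_time \<beta> (Suc m)"
    proof
      assume "j < air_time \<beta> (Suc m)"
      then have "\<Gamma> j \<omega> = \<Gamma> (j - 1) \<omega>"
        using m by (intro adaptation_times[OF w, of _ m]) auto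
      then show False using j by simp
    qed
    then have jm: "j = air_time \<beta> (Suc m)" using m j by auto
    have "real (Suc m) \<le> ?r" using j by (intro air_time_le_imp) (simp add: jm[symmetric])
    then have "Suc m \<in> ?R" by (simp add: le_nat_floor del: of_nat_Suc)
    then show "j \<in> air_time \<beta> ` ?R" using jm by blast
  qed
  then have "card {j\<in>{1..n}. \<Gamma> j \<omega> \<noteq> \<Gamma> (j - 1) \<omega>} \<le> card ?R"
    using surj_card_le[of ?R] by blast
  also have "card ?R = nat \<lfloor>?r\<rfloor>" by simp
  finally have "card {j\<in>{1..n}. \<Gamma> j \<omega> \<noteq> \<Gamma> (j - 1) \<omega>} \<le> nat \<lfloor>?r\<rfloor>" .
  moreover have "real (nat \<lfloor>?r\<rfloor>) \<le> ?r" by (intro of_nat_floor) simp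
  ultimately show ?thesis by linarith
qed

end

section \<open>The strong law\<close>

locale air_contraction = air_chain \<nu> I \<pi> P M \<beta> Y \<Gamma> U y0 \<gamma>0
  for \<nu> :: "'x::polish_space measure"
    and I :: "'i measure"
    and \<pi> :: "'i \<Rightarrow> ('x \<times> 'p::polish_space) measure"
    and P :: "'i \<Rightarrow> ('x \<times> 'p) \<Rightarrow> ('x \<times> 'p) measure"
    and M :: "'w measure"
    and \<beta> :: real
    and Y :: "nat \<Rightarrow> 'w \<Rightarrow> 'x \<times> 'p"
    and \<Gamma> :: "nat \<Rightarrow> 'w \<Rightarrow> 'i"
    and U :: "nat \<Rightarrow> (nat \<Rightarrow> 'x \<times> 'p) \<times> (nat \<Rightarrow> 'i) \<Rightarrow> 'i"
    and y0 :: "'x \<times> 'p"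
    and \<gamma>0 :: 'i +
  fixes d :: "'x \<times> 'p \<Rightarrow> 'x \<times> 'p \<Rightarrow> real"
    and V :: "'x \<times> 'p \<Rightarrow> real"
    and f :: "'x \<Rightarrow> real"
    and C \<tau> \<kappa> b p K L :: real
    and k0 :: nat
  assumes d: "distance_like d"
    and C: "1 \<le> C" "\<And>\<gamma>. \<gamma> \<in> space I \<Longrightarrow> contraction_coeff d (P \<gamma>) \<le> ennreal C"
    and \<tau>: "0 < \<tau>" "\<tau> < 1" and k0: "1 \<le> k0"
    and contr: "\<And>\<gamma>. \<gamma> \<in> space I \<Longrightarrow> contraction_coeff d (kernel_power (P \<gamma>) k0) \<le> ennreal \<tau>"
    and V[measurable]: "V \<in> borel_measurable borel" and V_ge: "\<And>y. 1 \<le> V y"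
    and \<kappa>: "0 < \<kappa>" "\<kappa> < 1" and b: "0 < b"
    and drift: "\<And>\<gamma> y. \<gamma> \<in> space I \<Longrightarrow> (\<integral>\<^sup>+z. ennreal (V z) \<partial>P \<gamma> y) \<le> ennreal (\<kappa> * V y + b)"
    and p: "2 \<le> p" and K: "0 < K"
    and d_le: "\<And>x y. d x y \<le> K * (V x powr (1 / p) + V y powr (1 / p))"
    and f[measurable]: "f \<in> borel_measurable borel"
    and L: "0 < L" "lipschitz_wrt d L (\<lambda>y. f (fst y))"
    and f_le: "\<And>y. \<bar>f (fst y)\<bar> \<le> V y powr (1 / p)"
begin

abbreviation "h \<equiv> \<lambda>y :: 'x \<times> 'p. f (fst y)"
abbreviation "c \<equiv> \<integral>x. f x \<partial>\<nu>"
abbreviation "W y \<equiv> V y powr (1 / p)"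

lemma h_measurable[measurable]: "h \<in> borel_measurable borel"
  by (rule measurable_compose[OF measurable_fst_borel f])

lemma contracting: "\<gamma> \<in> space I \<Longrightarrow> contracting_kernel (P \<gamma>) (\<pi> \<gamma>) d V h C \<tau> \<kappa> b p K L k0"
  by (intro contracting_kernel.intro kernel prob_pi sets_pi invariant d C \<tau> k0 contr V V_ge \<kappa> b drift K
      d_le h_measurable L f_le order_trans[OF one_le_numeral p])

text \<open>Centring by \<open>c\<close> keeps \<open>\<pi>\<close> out of the definition, so joint
  measurability in \<gamma> and \<open>y\<close> is available; for \<gamma> in
  \<open>space I\<close> it is the Poisson solution by \<open>integral_pi_fst\<close>.\<close>

definition G where "G \<gamma> = poisson_solution (P \<gamma>) h c"
definition A where "A = contracting_kernel.poisson_bound C \<tau> \<kappa> b K L k0"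

lemma Gamma_in[simp]: "\<omega> \<in> space M \<Longrightarrow> \<Gamma> n \<omega> \<in> space I"
  using measurable_space[OF measurable_Gamma] by blast

lemma G_measurable: "(\<lambda>(\<gamma>, y). G \<gamma> y) \<in> borel_measurable (I \<Otimes>\<^sub>M borel)"
  unfolding G_def by (rule poisson_solution_jointly_measurable[OF h_measurable])

lemma G_le: "\<gamma> \<in> space I \<Longrightarrow> \<bar>G \<gamma> y\<bar> \<le> A * W y"
  using contracting_kernel.poisson_solution_le[OF contracting, of \<gamma> y]
  by (simp add: G_def A_def integral_pi_fst)

lemma W_ge: "1 \<le> W y"
  using V_ge[of y] p by (simp add: ge_one_powr_ge_zero)

text \<open>Here \<open>p \<ge> 2\<close> is used: the first moment of \<open>V\<close> bounds the
  second moment of anything dominated by \<open>W\<close>.\<close>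

lemma W_sq_le: "(W y)\<^sup>2 \<le> V y"
proof -
  have "(W y)\<^sup>2 = V y powr (2 / p)" by (simp add: power2_eq_square powr_add[symmetric])
  also have "\<dots> \<le> V y powr 1" using V_ge[of y] p by (intro powr_mono) auto
  finally show ?thesis using V_ge[of y] by simp
qed

lemma A_nonneg: "0 \<le> A"
proof -
  obtain \<omega> where "\<omega> \<in> space M" using not_empty by blast
  then have "\<bar>G (\<Gamma> 0 \<omega>) y0\<bar> \<le> A * W y0" by (intro G_le) simp
  then have "0 \<le> A * W y0" by linarith
  then show ?thesis using W_ge[of y0] zero_le_mult_iff[of A "W y0"] by linarith
qed

lemma G_poisson:
  assumes "\<gamma> \<in> space I"
  shows "integrable (P \<gamma> y) (G \<gamma>)" "(\<integral>z. G \<gamma> z \<partial>P \<gamma> y) = G \<gamma> y - (h y - c)"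
proof -
  interpret contracting_kernel "P \<gamma>" "\<pi> \<gamma>" d V h C \<tau> \<kappa> b p K L k0
    by (rule contracting[OF assms])
  show "(\<integral>z. G \<gamma> z \<partial>P \<gamma> y) = G \<gamma> y - (h y - c)"
    using poisson_equation[of y] by (simp add: G_def integral_pi_fst[OF assms f])
  have "\<bar>G \<gamma> z\<bar> \<le> A * V z" for z
    using G_le[OF assms, of z] mult_left_mono[OF V_root_le A_nonneg, of z] by linarith
  moreover have "G \<gamma> \<in> borel_measurable borel"
    using poisson_solution_measurable by (simp add: G_def integral_pi_fst[OF assms f])
  ultimately show "integrable (P \<gamma> y) (G \<gamma>)" by (rule integrable_P(1)[rotated])
qed

section \<open>Moments and almost sure growth of \<open>V\<close> along the chain\<close>

definition moment where "moment = V y0 + b / (1 - \<kappa>)"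

lemma moment_pos: "0 < moment"
  unfolding moment_def using V_ge[of y0] \<kappa> b by (intro add_pos_pos) auto

lemma nn_integral_V_Y: "(\<integral>\<^sup>+\<omega>. ennreal (V (Y n \<omega>)) \<partial>M) \<le> ennreal moment"
proof (induction n)
  case 0
  have "(\<integral>\<^sup>+\<omega>. ennreal (V (Y 0 \<omega>)) \<partial>M) = (\<integral>\<^sup>+\<omega>. ennreal (V y0) \<partial>M)"
    by (intro nn_integral_cong) (use start in auto)
  also have "\<dots> = ennreal (V y0)" by (simp add: emeasure_space_1)
  also have "\<dots> \<le> ennreal moment" using \<kappa> b by (intro ennreal_leI) (simp add: moment_def)
  finally show ?case .
next
  case (Suc n)
  note measurable_Y[measurable]
  have "(\<integral>\<^sup>+\<omega>. ennreal (V (Y (Suc n) \<omega>)) \<partial>M) = (\<integral>\<^sup>+\<omega>. \<integral>\<^sup>+y. ennreal (V y) \<partial>next_law n \<omega> \<partial>M)"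
    using nn_integral_transition[of "\<lambda>z. V (snd z)" n] by simp
  also have "\<dots> \<le> (\<integral>\<^sup>+\<omega>. ennreal \<kappa> * ennreal (V (Y n \<omega>)) + ennreal b \<partial>M)"
  proof (rule nn_integral_mono)
    fix \<omega> assume "\<omega> \<in> space M"
    then have "(\<integral>\<^sup>+y. ennreal (V y) \<partial>next_law n \<omega>) \<le> ennreal (\<kappa> * V (Y n \<omega>) + b)"
      unfolding next_law_def by (intro drift) simp
    also have "\<dots> = ennreal \<kappa> * ennreal (V (Y n \<omega>)) + ennreal b"
      using \<kappa> b V_ge[of "Y n \<omega>"] by (simp add: ennreal_mult)
    finally show "(\<integral>\<^sup>+y. ennreal (V y) \<partial>next_law n \<omega>) \<le> ennreal \<kappa> * ennreal (V (Y n \<omega>)) + ennreal b" .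
  qed
  also have "\<dots> = ennreal \<kappa> * (\<integral>\<^sup>+\<omega>. ennreal (V (Y n \<omega>)) \<partial>M) + ennreal b"
    by (simp add: nn_integral_add nn_integral_cmult emeasure_space_1)
  also have "\<dots> \<le> ennreal \<kappa> * ennreal moment + ennreal b"
    by (intro add_right_mono mult_left_mono Suc) simp
  also have "\<dots> = ennreal (\<kappa> * moment + b)"
    using \<kappa> b moment_pos by (simp add: ennreal_mult)
  also have "\<dots> \<le> ennreal moment"
  proof (rule ennreal_leI)
    \<comment> \<open>\<open>b / (1 - \<kappa>)\<close> is the fixed point of one drift step and
      \<open>V y0\<close> covers the deterministic start, so their sum persists as an upper
      bound.\<close>
    have "\<kappa> * V y0 \<le> V y0" using \<kappa> V_ge[of y0] by simp
    moreover have "\<kappa> * (b / (1 - \<kappa>)) + b = b / (1 - \<kappa>)" using \<kappa> by (simp add: field_simps)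
    ultimately show "\<kappa> * moment + b \<le> moment" unfolding moment_def by (simp add: distrib_left)
  qed
  finally show ?case .
qed

lemma V_Y_integrable: "integrable M (\<lambda>\<omega>. V (Y n \<omega>))"
  and V_Y_expectation: "expectation (\<lambda>\<omega>. V (Y n \<omega>)) \<le> moment"
proof -
  note measurable_Y[measurable]
  have nn: "0 \<le> V y" for y using V_ge[of y] by simp
  show int: "integrable M (\<lambda>\<omega>. V (Y n \<omega>))"
    using nn_integral_V_Y[of n] nn by (intro integrableI_bounded) (auto simp: less_top[symmetric] top_unique)
  have "ennreal (expectation (\<lambda>\<omega>. V (Y n \<omega>))) \<le> ennreal moment"
    using nn_integral_V_Y[of n] nn by (subst nn_integral_eq_integral[symmetric, OF int]) auto
  then show "expectation (\<lambda>\<omega>. V (Y n \<omega>)) \<le> moment" using moment_pos by simp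
qed

text \<open>The series of \<open>real n powr (- (1 + \<delta>)) * V (Y n \<omega>)\<close> has
  finite expectation, hence is finite almost surely. Each term is at most the sum, which gives the
  random constant \<open>S\<close> from first moments alone.\<close>

lemma V_Y_growth:
  assumes \<delta>: "0 < \<delta>"
  shows "AE \<omega> in M. \<exists>S\<ge>0. \<forall>n\<ge>1. V (Y n \<omega>) \<le> S * real n powr (1 + \<delta>)"
proof -
  note measurable_Y[measurable]
  let ?u = "\<lambda>n \<omega>. ennreal (real (Suc n) powr (- (1 + \<delta>))) * ennreal (V (Y (Suc n) \<omega>))"
  have sum: "summable (\<lambda>n. real (Suc n) powr (- (1 + \<delta>)))"
    using \<delta> by (subst summable_Suc_iff) (simp add: summable_real_powr_iff)
  have "(\<integral>\<^sup>+\<omega>. (\<Sum>n. ?u n \<omega>) \<partial>M) = (\<Sum>n. \<integral>\<^sup>+\<omega>. ?u n \<omega> \<partial>M)"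
    by (rule nn_integral_suminf) measurable
  also have "\<dots> = (\<Sum>n. ennreal (real (Suc n) powr (- (1 + \<delta>))) * (\<integral>\<^sup>+\<omega>. ennreal (V (Y (Suc n) \<omega>)) \<partial>M))"
    by (subst nn_integral_cmult) auto
  also have "\<dots> \<le> (\<Sum>n. ennreal (real (Suc n) powr (- (1 + \<delta>))) * ennreal moment)"
    by (intro suminf_le mult_left_mono nn_integral_V_Y) auto
  also have "\<dots> = (\<Sum>n. ennreal (real (Suc n) powr (- (1 + \<delta>)) * moment))"
    using moment_pos by (simp add: ennreal_mult)
  also have "\<dots> < \<top>"
    by (subst suminf_ennreal2[OF _ summable_mult2[OF sum]]) (use moment_pos in auto)
  finally have "(\<integral>\<^sup>+\<omega>. (\<Sum>n. ?u n \<omega>) \<partial>M) \<noteq> \<infinity>" by simp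
  then have "AE \<omega> in M. (\<Sum>n. ?u n \<omega>) \<noteq> \<infinity>"
    by (rule nn_integral_PInf_AE[rotated]) measurable
  then show ?thesis
  proof eventually_elim
    case (elim \<omega>)
    then obtain S where S: "0 \<le> S" "(\<Sum>n. ?u n \<omega>) = ennreal S"
      by (cases "\<Sum>n. ?u n \<omega>" rule: ennreal_cases) auto
    have "V (Y n \<omega>) \<le> S * real n powr (1 + \<delta>)" if n: "1 \<le> n" for n
    proof -
      obtain m where m: "n = Suc m" using n by (cases n) auto
      have "?u m \<omega> \<le> (\<Sum>n. ?u n \<omega>)"
        using sum_le_suminf[of "\<lambda>n. ?u n \<omega>" "{m}"] by simp
      then have "real n powr (- (1 + \<delta>)) * V (Y n \<omega>) \<le> S"
        using S V_ge[of "Y n \<omega>"] by (simp add: m ennreal_mult[symmetric] del: of_nat_Suc)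
      then have "real n powr (1 + \<delta>) * (real n powr (- (1 + \<delta>)) * V (Y n \<omega>)) \<le> real n powr (1 + \<delta>) * S"
        by (rule mult_left_mono) simp
      moreover have "real n powr (1 + \<delta>) * real n powr (- (1 + \<delta>)) = 1"
        unfolding powr_add[symmetric] using n by simp
      ultimately show ?thesis
        by (simp only: mult.assoc[symmetric] mult_1_left mult.commute[of S])
    qed
    with S show ?case by blast
  qed
qed

text \<open>By the Poisson equation this equals \<open>G (\<Gamma> n \<omega>) (Y (Suc n) \<omega>)\<close> minus its conditional expectation
  given the history up to time \<open>n\<close>.\<close>

definition \<Delta> where "\<Delta> n \<omega> = G (\<Gamma> n \<omega>) (Y (Suc n) \<omega>) - G (\<Gamma> n \<omega>) (Y n \<omega>) + (h (Y n \<omega>) - c)"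

lemma G_Gamma_measurable:
  assumes "i \<le> m" "j \<le> m"
  shows "(\<lambda>\<omega>. G (\<Gamma> i \<omega>) (Y j \<omega>)) \<in> borel_measurable (history m)"
proof -
  have "(\<lambda>\<omega>. (\<Gamma> i \<omega>, Y j \<omega>)) \<in> history m \<rightarrow>\<^sub>M I \<Otimes>\<^sub>M borel"
    using Gamma_adapted[OF assms(1)] Y_adapted[OF assms(2)] by measurable
  from measurable_compose[OF this G_measurable] show ?thesis by simp
qed

lemma \<Delta>_adapted: "\<Delta> n \<in> borel_measurable (history (Suc n))"
proof -
  have [measurable]: "(\<lambda>\<omega>. G (\<Gamma> n \<omega>) (Y (Suc n) \<omega>)) \<in> borel_measurable (history (Suc n))"
    "(\<lambda>\<omega>. G (\<Gamma> n \<omega>) (Y n \<omega>)) \<in> borel_measurable (history (Suc n))"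
    "Y n \<in> history (Suc n) \<rightarrow>\<^sub>M borel"
    by (simp_all add: G_Gamma_measurable Y_adapted)
  have [measurable]: "(\<lambda>\<omega>. h (Y n \<omega>)) \<in> borel_measurable (history (Suc n))"
    by (rule measurable_compose[OF _ h_measurable]) measurable
  show ?thesis unfolding \<Delta>_def by measurable
qed

text \<open>The factor 4 is 2 from squaring a sum of two roots times 2 from adding the moments at
  two successive times; \<open>A\<close>, 1 and \<open>\<bar>c\<bar>\<close> account for
  \<open>G\<close>, \<open>h\<close> and \<open>c\<close> relative to \<open>W\<close>.\<close>

definition var_bound where "var_bound = 4 * (A + 1 + \<bar>c\<bar>)\<^sup>2 * moment"

lemma \<Delta>_sq_le:
  assumes w: "\<omega> \<in> space M"
  shows "(\<Delta> n \<omega>)\<^sup>2 \<le> 2 * (A + 1 + \<bar>c\<bar>)\<^sup>2 * (V (Y n \<omega>) + V (Y (Suc n) \<omega>))"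
proof -
  let ?a = "A + 1 + \<bar>c\<bar>" and ?w = "W (Y n \<omega>)" and ?w' = "W (Y (Suc n) \<omega>)"
  have "\<bar>c\<bar> * 1 \<le> \<bar>c\<bar> * ?w" by (intro mult_left_mono W_ge) simp
  moreover have "A * ?w' \<le> ?a * ?w'" by (intro mult_right_mono) auto
  moreover have "?a * ?w = A * ?w + ?w + \<bar>c\<bar> * ?w" by (simp add: distrib_right)
  moreover have "\<bar>\<Delta> n \<omega>\<bar> \<le> A * ?w' + A * ?w + ?w + \<bar>c\<bar>"
  proof -
    have "\<bar>x - y + (z - t)\<bar> \<le> \<bar>x\<bar> + \<bar>y\<bar> + \<bar>z\<bar> + \<bar>t\<bar>" for x y z t :: real by linarith
    then show ?thesis
      unfolding \<Delta>_def by (rule order_trans) (intro add_mono G_le f_le Gamma_in w order_refl)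
  qed
  ultimately have "\<bar>\<Delta> n \<omega>\<bar> \<le> ?a * (?w + ?w')"
    unfolding distrib_left[of ?a ?w ?w'] by linarith
  then have "(\<Delta> n \<omega>)\<^sup>2 \<le> (?a * (?w + ?w'))\<^sup>2"
    by (metis abs_ge_zero power2_abs power_mono)
  also have "\<dots> = ?a\<^sup>2 * (?w + ?w')\<^sup>2" by (rule power_mult_distrib)
  also have "\<dots> \<le> ?a\<^sup>2 * (2 * (V (Y n \<omega>) + V (Y (Suc n) \<omega>)))"
  proof (rule mult_left_mono)
    have "(?w + ?w')\<^sup>2 \<le> 2 * (?w\<^sup>2 + ?w'\<^sup>2)"
      using sum_squares_bound[of ?w ?w'] by (simp add: power2_sum)
    also have "\<dots> \<le> 2 * (V (Y n \<omega>) + V (Y (Suc n) \<omega>))"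
      by (intro mult_left_mono add_mono W_sq_le) simp
    finally show "(?w + ?w')\<^sup>2 \<le> 2 * (V (Y n \<omega>) + V (Y (Suc n) \<omega>))" .
  qed simp
  finally show ?thesis by (simp only: mult_ac)
qed

text \<open>Indices are shifted by one because the centred sum starts at \<open>j = 1\<close>.
  Orthogonality comes from the Poisson equation: given the past, the mean of \<open>G\<close> at the
  next state, under the current parameter, cancels the remaining terms of
  \<open>\<Delta>\<close>.\<close>

lemma martingale_differences:
  "L2_martingale_differences M (\<lambda>n. history (Suc n)) (\<lambda>n. \<Delta> (Suc n)) var_bound"
proof
  fix n
  show "subalgebra M (history (Suc n))" by (rule history_subalgebra)
  show "subalgebra (history (Suc (Suc n))) (history (Suc n))" by (rule history_filtration)
  show "\<Delta> (Suc n) \<in> borel_measurable (history (Suc (Suc n)))" by (rule \<Delta>_adapted)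
  let ?b = "\<lambda>\<omega>. 2 * (A + 1 + \<bar>c\<bar>)\<^sup>2 * (V (Y (Suc n) \<omega>) + V (Y (Suc (Suc n)) \<omega>))"
  have [measurable]: "\<Delta> (Suc n) \<in> borel_measurable M"
    by (rule measurable_from_subalg[OF history_subalgebra \<Delta>_adapted])
  have ib: "integrable M ?b" using V_Y_integrable by simp
  show sq: "integrable M (\<lambda>\<omega>. (\<Delta> (Suc n) \<omega>)\<^sup>2)"
  proof (rule Bochner_Integration.integrable_bound[OF ib])
    show "AE \<omega> in M. norm ((\<Delta> (Suc n) \<omega>)\<^sup>2) \<le> norm (?b \<omega>)"
      using \<Delta>_sq_le[of _ "Suc n"] by (auto intro!: AE_I2 intro: order_trans[OF _ abs_ge_self])
  qed measurable
  have "expectation (\<lambda>\<omega>. (\<Delta> (Suc n) \<omega>)\<^sup>2) \<le> expectation ?b"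
    by (intro integral_mono sq ib \<Delta>_sq_le)
  also have "\<dots> = 2 * (A + 1 + \<bar>c\<bar>)\<^sup>2 * (expectation (\<lambda>\<omega>. V (Y (Suc n) \<omega>)) + expectation (\<lambda>\<omega>. V (Y (Suc (Suc n)) \<omega>)))"
    using V_Y_integrable by simp
  also have "\<dots> \<le> 2 * (A + 1 + \<bar>c\<bar>)\<^sup>2 * (moment + moment)"
    by (intro mult_left_mono add_mono V_Y_expectation) simp
  finally show "expectation (\<lambda>\<omega>. (\<Delta> (Suc n) \<omega>)\<^sup>2) \<le> var_bound"
    by (simp add: var_bound_def)
  fix Z :: "'w \<Rightarrow> real" assume Z: "Z \<in> borel_measurable (history (Suc n))" and Zsq: "integrable M (\<lambda>\<omega>. (Z \<omega>)\<^sup>2)"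
  have [measurable]: "Z \<in> borel_measurable M"
    by (rule measurable_from_subalg[OF history_subalgebra Z])
  have int: "integrable M (\<lambda>\<omega>. Z \<omega> * \<Delta> (Suc n) \<omega>)"
    by (rule integrable_mult_of_sq) (use Zsq sq in auto)
  let ?m = "Suc n"
  \<comment> \<open>The product of \<open>Z\<close> and \<open>\<Delta>\<close> as a function of the
    past and a free next state; the parameter and the current state are read from the first
    coordinate.\<close>
  define \<Phi> where "\<Phi> z = Z (fst z) * (G (\<Gamma> ?m (fst z)) (snd z) - G (\<Gamma> ?m (fst z)) (Y ?m (fst z)) + (h (Y ?m (fst z)) - c))"
    for z :: "'w \<times> 'x \<times> 'p"
  have fst': "fst \<in> history ?m \<Otimes>\<^sub>M (borel :: ('x \<times> 'p) measure) \<rightarrow>\<^sub>M history ?m" by (rule measurable_fst)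
  have "(\<lambda>z. (\<Gamma> ?m (fst z), snd z)) \<in> history ?m \<Otimes>\<^sub>M (borel :: ('x \<times> 'p) measure) \<rightarrow>\<^sub>M I \<Otimes>\<^sub>M borel"
    using measurable_compose[OF fst' Gamma_adapted[of ?m ?m]] by measurable
  from measurable_compose[OF this G_measurable]
  have m1: "(\<lambda>z. G (\<Gamma> ?m (fst z)) (snd z)) \<in> borel_measurable (history ?m \<Otimes>\<^sub>M (borel :: ('x \<times> 'p) measure))"
    by simp
  note m2 = measurable_compose[OF fst' G_Gamma_measurable[of ?m ?m ?m]]
  note m3 = measurable_compose[OF fst' measurable_compose[OF Y_adapted[of ?m ?m] h_measurable]]
  have \<Phi>: "\<Phi> \<in> borel_measurable (history ?m \<Otimes>\<^sub>M borel)"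
    unfolding \<Phi>_def
    by (intro borel_measurable_times borel_measurable_add borel_measurable_diff m1 m2 m3
        measurable_compose[OF fst' Z] borel_measurable_const order_refl)
  have "(\<integral>\<omega>. Z \<omega> * \<Delta> ?m \<omega> \<partial>M) = (\<integral>\<omega>. \<integral>y. \<Phi> (\<omega>, y) \<partial>next_law ?m \<omega> \<partial>M)"
    using integral_transition[OF \<Phi>] int by (simp add: \<Phi>_def \<Delta>_def)
  also have "\<dots> = (\<integral>\<omega>. 0 \<partial>M)"
  proof (rule Bochner_Integration.integral_cong)
    fix \<omega> assume w: "\<omega> \<in> space M"
    interpret N: prob_space "next_law ?m \<omega>" by (rule prob_next_law[OF w])
    have iG: "integrable (next_law ?m \<omega>) (G (\<Gamma> ?m \<omega>))"
      and eG: "N.expectation (G (\<Gamma> ?m \<omega>)) = G (\<Gamma> ?m \<omega>) (Y ?m \<omega>) - (h (Y ?m \<omega>) - c)"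
      unfolding next_law_def using w by (intro G_poisson; simp)+
    show "(\<integral>y. \<Phi> (\<omega>, y) \<partial>next_law ?m \<omega>) = 0"
      using iG eG by (simp add: \<Phi>_def N.prob_space)
  qed simp
  finally show "(\<integral>\<omega>. Z \<omega> * \<Delta> ?m \<omega> \<partial>M) = 0" by simp
qed

text \<open>Solve the definition of \<open>\<Delta>\<close> for \<open>h - c\<close> and insert
  \<open>G (\<Gamma> (j - 1) \<omega>) (Y j \<omega>)\<close>: the differences from one state to the
  next telescope, and what is left at \<open>j\<close> is zero unless the parameter changes
  there.\<close>

lemma sum_decomposition:
  "(\<Sum>j=1..n. h (Y j \<omega>) - c) = (\<Sum>j<n. \<Delta> (Suc j) \<omega>)
    + (G (\<Gamma> 0 \<omega>) (Y 1 \<omega>) - G (\<Gamma> n \<omega>) (Y (Suc n) \<omega>)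
      + (\<Sum>j=1..n. G (\<Gamma> j \<omega>) (Y j \<omega>) - G (\<Gamma> (j - 1) \<omega>) (Y j \<omega>)))"
  by (induction n) (simp_all add: \<Delta>_def)

text \<open>The three summands of the constant belong to the two end terms and to the changes of
  parameter. \<open>2 powr q\<close> comes from \<open>Suc n \<le> 2 * n\<close>; the 4 is two
  values of \<open>G\<close> per change times the 2 of \<open>adaptation_count\<close>.\<close>

lemma boundary_bound:
  assumes w: "\<omega> \<in> space M" and S: "0 \<le> S" and q: "0 \<le> q"
    and growth: "\<And>n. 1 \<le> n \<Longrightarrow> W (Y n \<omega>) \<le> S * real n powr q" and n: "1 \<le> n"
  shows "\<bar>G (\<Gamma> 0 \<omega>) (Y 1 \<omega>) - G (\<Gamma> n \<omega>) (Y (Suc n) \<omega>)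
      + (\<Sum>j=1..n. G (\<Gamma> j \<omega>) (Y j \<omega>) - G (\<Gamma> (j - 1) \<omega>) (Y j \<omega>))\<bar>
    \<le> (A * S + A * S * 2 powr q + 4 * A * S) * real n powr (q + 1 / (1 + \<beta>))"
proof -
  let ?r = "1 / (1 + \<beta>)"
  let ?D = "\<lambda>j. G (\<Gamma> j \<omega>) (Y j \<omega>) - G (\<Gamma> (j - 1) \<omega>) (Y j \<omega>)"
  let ?J = "{j\<in>{1..n}. \<Gamma> j \<omega> \<noteq> \<Gamma> (j - 1) \<omega>}"
  let ?N = "real n powr (q + ?r)"
  have r: "0 \<le> ?r" using beta_pos by simp
  have AS: "0 \<le> A * S" using A_nonneg S by simp
  have Gb: "\<bar>G (\<Gamma> i \<omega>) (Y j \<omega>)\<bar> \<le> A * S * real j powr q" if "1 \<le> j" for i j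
  proof -
    have "\<bar>G (\<Gamma> i \<omega>) (Y j \<omega>)\<bar> \<le> A * W (Y j \<omega>)" using w by (intro G_le) simp
    also have "\<dots> \<le> A * (S * real j powr q)" by (intro mult_left_mono growth that A_nonneg)
    finally show ?thesis by (simp add: mult.assoc)
  qed
  have N1: "1 \<le> ?N" using n q r by (intro ge_one_powr_ge_zero) auto
  have Nq: "real n powr q \<le> ?N" using n r by (intro powr_mono) auto
  have t1: "\<bar>G (\<Gamma> 0 \<omega>) (Y 1 \<omega>)\<bar> \<le> A * S * ?N"
    using Gb[of 1 0] mult_left_mono[OF N1 AS] by simp
  have "real (Suc n) powr q \<le> (2 * real n) powr q" using n q by (intro powr_mono2) auto
  also have "\<dots> = 2 powr q * real n powr q" by (simp add: powr_mult)
  also have "\<dots> \<le> 2 powr q * ?N" by (intro mult_left_mono Nq) simp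
  finally have "A * S * real (Suc n) powr q \<le> A * S * (2 powr q * ?N)" by (rule mult_left_mono[OF _ AS])
  then have t2: "\<bar>G (\<Gamma> n \<omega>) (Y (Suc n) \<omega>)\<bar> \<le> A * S * 2 powr q * ?N"
    using Gb[of "Suc n" n] by (simp add: mult.assoc)
  have "\<bar>\<Sum>j=1..n. ?D j\<bar> = \<bar>\<Sum>j\<in>?J. ?D j\<bar>"
    by (intro arg_cong[of _ _ abs] sum.mono_neutral_right) auto
  also have "\<dots> \<le> (\<Sum>j\<in>?J. \<bar>?D j\<bar>)" by (rule sum_abs)
  also have "\<dots> \<le> (\<Sum>j\<in>?J. 2 * (A * S) * real n powr q)"
  proof (rule sum_mono)
    fix j assume "j \<in> ?J"
    then have j: "1 \<le> j" "j \<le> n" by auto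
    have "A * S * real j powr q \<le> A * S * real n powr q"
      using j q by (intro mult_left_mono AS powr_mono2) auto
    then show "\<bar>?D j\<bar> \<le> 2 * (A * S) * real n powr q"
      using Gb[OF j(1), of j] Gb[OF j(1), of "j - 1"] by linarith
  qed
  also have "\<dots> = real (card ?J) * (2 * (A * S) * real n powr q)" by simp
  also have "\<dots> \<le> (2 * real n powr ?r) * (2 * (A * S) * real n powr q)"
    using AS by (intro mult_right_mono adaptation_count w) simp
  also have "\<dots> = 4 * A * S * ?N" by (simp add: powr_add)
  finally have t3: "\<bar>\<Sum>j=1..n. ?D j\<bar> \<le> 4 * A * S * ?N" .
  show ?thesis using t1 t2 t3 unfolding distrib_right by linarith
qed

lemma strong_law_rate:
  assumes \<epsilon>: "max 0 (1 / (1 + \<beta>) + 1 / p - 1 / 2) < \<epsilon>"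
  shows "AE \<omega> in M. (\<lambda>n. 1 / real n powr (1 / 2 + \<epsilon>) * (\<Sum>j=1..n. h (Y j \<omega>) - c)) \<longlonglongrightarrow> 0"
proof -
  interpret D: L2_martingale_differences M "\<lambda>n. history (Suc n)" "\<lambda>n. \<Delta> (Suc n)" var_bound
    by (rule martingale_differences)
  \<comment> \<open>\<open>gap\<close> is the distance of \<epsilon> from the second part of the
    threshold. Half of it is given to the growth of \<open>W (Y n \<omega>)\<close>, with
    \<open>\<delta>\<close> chosen so that this root of \<open>V\<close> grows with exponent
    \<open>q\<close>; the other half is the final decay.\<close>
  define gap where "gap = 1 / 2 + \<epsilon> - (1 / (1 + \<beta>) + 1 / p)"
  have gap: "0 < gap" using \<epsilon> unfolding gap_def by simp
  define \<delta> where "\<delta> = p * gap / 2"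
  define q where "q = 1 / p + gap / 2"
  have q: "0 \<le> q" using p gap by (simp add: q_def)
  have \<delta>: "0 < \<delta>" "(1 + \<delta>) * (1 / p) = q"
    using p gap by (simp_all add: \<delta>_def q_def field_simps)
  have e: "0 < \<epsilon>" using \<epsilon> by simp
  from D.strong_law[OF e] V_Y_growth[OF \<delta>(1)] AE_space show ?thesis
  proof eventually_elim
    case (elim \<omega>)
    let ?R = "\<lambda>n. G (\<Gamma> 0 \<omega>) (Y 1 \<omega>) - G (\<Gamma> n \<omega>) (Y (Suc n) \<omega>)
      + (\<Sum>j=1..n. G (\<Gamma> j \<omega>) (Y j \<omega>) - G (\<Gamma> (j - 1) \<omega>) (Y j \<omega>))"
    obtain S where S: "0 \<le> S" "\<And>n. 1 \<le> n \<Longrightarrow> V (Y n \<omega>) \<le> S * real n powr (1 + \<delta>)"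
      using elim(2) by blast
    define S' where "S' = S powr (1 / p)"
    have growth: "W (Y n \<omega>) \<le> S' * real n powr q" if "1 \<le> n" for n
    proof -
      have "W (Y n \<omega>) \<le> (S * real n powr (1 + \<delta>)) powr (1 / p)"
        using S(2)[OF that] V_ge[of "Y n \<omega>"] p by (intro powr_mono2) auto
      also have "\<dots> = S' * real n powr q"
        using S(1) by (simp add: S'_def powr_mult powr_powr \<delta>(2)[simplified])
      finally show ?thesis .
    qed
    have S': "0 \<le> S'" by (simp add: S'_def)
    define B where "B = A * S' + A * S' * 2 powr q + 4 * A * S'"
    have "(\<lambda>n. ?R n / real n powr (1 / 2 + \<epsilon>)) \<longlonglongrightarrow> 0"
    proof (rule Lim_null_comparison)
      show "\<forall>\<^sub>F n in sequentially. norm (?R n / real n powr (1 / 2 + \<epsilon>)) \<le> B * real n powr (- (gap / 2))"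
        using eventually_ge_at_top[of 1]
      proof eventually_elim
        case (elim n)
        have "norm (?R n / real n powr (1 / 2 + \<epsilon>)) \<le> B * real n powr (q + 1 / (1 + \<beta>)) / real n powr (1 / 2 + \<epsilon>)"
          using boundary_bound[OF \<open>\<omega> \<in> space M\<close> S' q growth elim]
          by (simp add: B_def divide_right_mono)
        also have "\<dots> = B * real n powr (q + 1 / (1 + \<beta>) - (1 / 2 + \<epsilon>))"
          by (simp add: powr_diff)
        also have "q + 1 / (1 + \<beta>) - (1 / 2 + \<epsilon>) = - (gap / 2)"
        proof -
          \<comment> \<open>Proved for abstract reals, with \<open>x\<close>, \<open>r\<close>,
            \<open>E\<close> standing for \<open>1 / p\<close>, \<open>1 / (1 + \<beta>)\<close> and
            \<open>1 / 2 + \<epsilon>\<close>, so that \<open>field_simps\<close> leaves those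
            quotients alone.\<close>
          have "x + (E - (r + x)) / 2 + r - E = - ((E - (r + x)) / 2)" for x E r :: real
            by (simp add: field_simps)
          then show ?thesis unfolding q_def gap_def .
        qed
        finally show ?case .
      qed
      have "(\<lambda>n. real n powr (- (gap / 2))) \<longlonglongrightarrow> 0"
        by (rule tendsto_neg_powr) (use gap filterlim_real_sequentially in auto)
      from tendsto_mult_left[OF this, of B]
      show "(\<lambda>n. B * real n powr (- (gap / 2))) \<longlonglongrightarrow> 0" by simp
    qed
    from tendsto_add[OF elim(1) this]
    show ?case
      by (simp only: sum_decomposition add_divide_distrib times_divide_eq_left mult_1 add_0)
  qed
qed

end

theorem theorem3p11:
  fixes \<nu> :: "'x::polish_space measure"
    and I :: "'i measure"
    and \<pi> :: "'i \<Rightarrow> ('x \<times> 'p::polish_space) measure"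
    and P :: "'i \<Rightarrow> ('x \<times> 'p) \<Rightarrow> ('x \<times> 'p) measure"
    and M :: "'w measure"
    and Y :: "nat \<Rightarrow> 'w \<Rightarrow> 'x \<times> 'p"
    and \<Gamma> :: "nat \<Rightarrow> 'w \<Rightarrow> 'i"
    and U :: "nat \<Rightarrow> (nat \<Rightarrow> 'x \<times> 'p) \<times> (nat \<Rightarrow> 'i) \<Rightarrow> 'i"
    and y0 :: "'x \<times> 'p" and \<gamma>0 :: 'i
    and d :: "'x \<times> 'p \<Rightarrow> 'x \<times> 'p \<Rightarrow> real"
    and V :: "'x \<times> 'p \<Rightarrow> real"
    and f :: "'x \<Rightarrow> real"
    and \<beta> C \<tau> \<kappa> b p K L \<epsilon> :: real
    and k0 :: nat
  assumes "air_chain \<nu> I \<pi> P M \<beta> Y \<Gamma> U y0 \<gamma>0"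
    and "distance_like d"
    and "C \<ge> 1" and "0 \<le> \<tau>" and "\<tau> < 1" and "k0 \<ge> 1"
    and "\<And>\<gamma>. \<gamma> \<in> space I \<Longrightarrow> contraction_coeff d (P \<gamma>) \<le> ennreal C"
    and "\<And>\<gamma>. \<gamma> \<in> space I \<Longrightarrow> contraction_coeff d (kernel_power (P \<gamma>) k0) \<le> ennreal \<tau>"
    and "V \<in> borel_measurable borel" and "\<And>y. V y \<ge> 1"
    and "0 < \<kappa>" and "\<kappa> < 1" and "b > 0"
    and "\<And>\<gamma> y. \<gamma> \<in> space I \<Longrightarrow> (\<integral>\<^sup>+ y'. ennreal (V y') \<partial>P \<gamma> y) \<le> ennreal (\<kappa> * V y + b)"
    and "p > 2" and "K > 0"
    and "\<And>y1 y2. d y1 y2 \<le> K * (V y1 powr (1 / p) + V y2 powr (1 / p))"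
    and "f \<in> borel_measurable borel"
    and "L > 0"
    and "lipschitz_wrt d L (\<lambda>y. f (fst y))"
    and "\<And>y. \<bar>f (fst y)\<bar> \<le> V y powr (1 / p)"
    and "\<epsilon> > max 0 (1 / (1 + \<beta>) + 1 / p - 1 / 2)"
  shows "AE \<omega> in M.
    (\<lambda>n. 1 / real n powr (1 / 2 + \<epsilon>) *
          (\<Sum>j=1..n. (f (fst (Y j \<omega>)) - (\<integral>x. f x \<partial>\<nu>)))) \<longlonglongrightarrow> 0"
proof -
  interpret chain: air_chain \<nu> I \<pi> P M \<beta> Y \<Gamma> U y0 \<gamma>0 by fact
  \<comment> \<open>\<open>\<tau>\<close> may be 0, whereas the locale takes its root and divides by
    it; enlarging it to at least 1/2 keeps it a contraction bound below 1.\<close>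
  have "air_contraction \<nu> I \<pi> P M \<beta> Y \<Gamma> U y0 \<gamma>0 d V f C (max \<tau> (1 / 2)) \<kappa> b p K L k0"
  proof
    show "contraction_coeff d (kernel_power (P \<gamma>) k0) \<le> ennreal (max \<tau> (1 / 2))" if "\<gamma> \<in> space I" for \<gamma>
      using assms(8)[OF that] by (rule order_trans) (simp add: ennreal_leI)
  qed (use assms in auto)
  then show ?thesis using assms(22) by (rule air_contraction.strong_law_rate)
qed

end
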